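(* Assume that: (A.1) $A$ is irreducible; (A.2) $X_M$ has a periodic point for $\sigma$; (A.3) $\varphi:X\to\mathbb{R}$ is summable and $[\varphi]_{k+1}<\infty$ for some fixed integer $k\ge1$. Let $\Sigma=\bigcup_{ij\in S^2:M(ij)=1}[ij]$ and $\Sigma^n=\bigcap_{i=0}^n\sigma^{-i}\Sigma$. Let $(\lambda_A,h_A,\nu_A)$ be the unique triplet such that $\lambda_A=\exp(P(\varphi))$ is the spectral radius of $\mathcal{L}_A$ acting on $F^k_b(X)$, $h_A\in F^k_b(X)$ is nonnegative with $\mathcal{L}_Ah_A=\lambda_Ah_A$, $\nu_A$ is a Borel probability measure on $X$ with $\mathcal{L}_A^*\nu_A=\lambda_A\nu_A$, and $\nu_A(h_A)=1$; put $\mu_A=h_A\nu_A$. Then $$\lim_{n\to\infty}\frac1n\log\mu_A(\Sigma^n)=P(\varphi|_{X_M})-P(\varphi).$$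
   Context: Let $S$ be a countable set, $A=(A(ij))_{i,j\in S}$ a zero-one matrix, and $X=X_A=\{\omega=\omega_0\omega_1\cdots\in\prod_{n\ge0}S: A(\omega_i\omega_{i+1})=1 \text{ for all } i\ge 0\}$ with shift $(\sigma\omega)_n=\omega_{n+1}$. For $w\in S^n$, $[w]=\{\omega\in X:\omega_0\cdots\omega_{n-1}=w\}$. Fix $\theta\in(0,1)$ and the metric $d_\theta(\omega,\upsilon)=\theta^{\min\{n\ge0:\omega_n\ne\upsilon_n\}}$ for $\omega\ne\upsilon$, $d_\theta(\omega,\omega)=0$. For a function $f$ on $X$, $\mathrm{var}_n f=\sup\{|f(\omega)-f(\upsilon)|:\omega_i=\upsilon_i,\ 0\le i\le n-1\}$ and $[f]_k=\sup_{n\ge k}\mathrm{var}_nf/\theta^n$. $C_b(X)$ is the Banach space of bounded complex-valued continuous functions with norm $\|\cdot\|_\infty$; $F^k_b(X)$ is the Banach space of $f\in C_b(X)$ with $[f]_k<\infty$, with norm $\|f\|_k=\|f\|_\infty+[f]_k$. $S_0\subset S$ is nonempty and $M=(M(ij))_{i,j\in S_0}$ is a zero-one matrix with $M(ij)\le A(ij)$; put $M(ij)=0$ if $i\notin S_0$ or $j\notin S_0$. $X_M=\{\omega\in\prod_{n\ge0}S_0: M(\omega_n\omega_{n+1})=1\ \forall n\ge0\}\subset X$. $A$ is irreducible if for all $a,b\in S$ there are $n\ge1$ and a word $w_1\cdots w_{n+1}$ with $w_1=a$, $w_{n+1}=b$ and $A(w_iw_{i+1})=1$ for $1\le i\le n$.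 A function $\varphi:X\to\mathbb{R}$ is summable if $\sum_{s\in S:[s]\ne\emptyset}\exp(\sup_{[s]}\varphi)<\infty$. With $S_n\varphi=\sum_{i=0}^{n-1}\varphi\circ\sigma^i$, the topological pressure is $P(\varphi)=\lim_{n\to\infty}\frac1n\log\sum_{w\in S^n:[w]\neq\emptyset}\exp(\sup_{[w]}S_n\varphi)$, and $P(\varphi|_{X_M})$ is defined in the same way with $[w]$ replaced by $[w]\cap X_M$. The operator $\mathcal{L}_A$ is $\mathcal{L}_Af(\omega)=\sum_{a\in S:A(a\omega_0)=1}e^{\varphi(a\cdot\omega)}f(a\cdot\omega)$, where $a\cdot\omega=a\omega_0\omega_1\cdots$; it is bounded on $C_b(X)$ and $F^k_b(X)$. $\mathcal{L}_A^*\nu=\lambda\nu$ means $\int\mathcal{L}_Af\,d\nu=\lambda\int f\,d\nu$ for all $f\in C_b(X)$; $\nu(f)=\int f\,d\nu$. The measure $h_A\nu_A$ is $E\mapsto\int_Eh_A\,d\nu_A$; it is a $\sigma$-invariant Borel probability measure. *)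

theory Defs
  imports "HOL-Probability.Probability"
begin

section \<open>Countable Markov shifts\<close>

text \<open>
  The countable alphabet is a type of class \<^class>\<open>countable\<close>.  The shift space of a zero-one
  matrix over a sub-alphabet \<open>S\<close>: \<open>X\<close> is \<open>markov_shift UNIV A\<close>, and \<open>X\<^sub>M\<close> is
  \<open>markov_shift S\<^sub>0 M\<close>.
\<close>

definition markov_shift :: "'s set \<Rightarrow> ('s \<Rightarrow> 's \<Rightarrow> nat) \<Rightarrow> (nat \<Rightarrow> 's) set" where
  "markov_shift S A = {\<omega>. (\<forall>n. \<omega> n \<in> S) \<and> (\<forall>n. A (\<omega> n) (\<omega> (Suc n)) = 1)}"

definition left_shift :: "(nat \<Rightarrow> 's) \<Rightarrow> (nat \<Rightarrow> 's)" where
  "left_shift \<omega> = (\<lambda>n. \<omega> (Suc n))"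

definition prepend :: "'s \<Rightarrow> (nat \<Rightarrow> 's) \<Rightarrow> (nat \<Rightarrow> 's)" where
  "prepend a \<omega> = case_nat a \<omega>"

text \<open>\<open>[w] \<inter> Y\<close>; the cylinder \<open>[w]\<close> itself is the case where \<open>Y\<close> is the whole space \<open>X\<close>.\<close>

definition cylinder :: "(nat \<Rightarrow> 's) set \<Rightarrow> 's list \<Rightarrow> (nat \<Rightarrow> 's) set" where
  "cylinder Y w = {\<omega> \<in> Y. \<forall>i<length w. \<omega> i = w ! i}"

definition irreducible_matrix :: "('s \<Rightarrow> 's \<Rightarrow> nat) \<Rightarrow> bool" where
  "irreducible_matrix A \<longleftrightarrow>
     (\<forall>a b. \<exists>n\<ge>1. \<exists>w. length w = n + 1 \<and> w ! 0 = a \<and> w ! n = b \<and>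
        (\<forall>i<n. A (w ! i) (w ! (i + 1)) = 1))"

definition has_periodic_point :: "(nat \<Rightarrow> 's) set \<Rightarrow> bool" where
  "has_periodic_point Y \<longleftrightarrow> (\<exists>\<omega>\<in>Y. \<exists>p\<ge>1. (left_shift ^^ p) \<omega> = \<omega>)"

definition dist_theta :: "real \<Rightarrow> (nat \<Rightarrow> 's) \<Rightarrow> (nat \<Rightarrow> 's) \<Rightarrow> real" where
  "dist_theta \<theta> \<omega> \<upsilon> = (if \<omega> = \<upsilon> then 0 else \<theta> ^ (LEAST n. \<omega> n \<noteq> \<upsilon> n))"

definition top_theta :: "real \<Rightarrow> (nat \<Rightarrow> 's) set \<Rightarrow> (nat \<Rightarrow> 's) topology" where
  "top_theta \<theta> X = Metric_space.mtopology X (dist_theta \<theta>)"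

definition borel_theta :: "real \<Rightarrow> (nat \<Rightarrow> 's) set \<Rightarrow> (nat \<Rightarrow> 's) measure" where
  "borel_theta \<theta> X = sigma X {U. openin (top_theta \<theta> X) U}"


section \<open>Function spaces\<close>

text \<open>Variations and Lipschitz constants may be infinite, hence the values in \<^typ>\<open>ennreal\<close>.\<close>

definition variation ::
    "(nat \<Rightarrow> 's) set \<Rightarrow> nat \<Rightarrow> ((nat \<Rightarrow> 's) \<Rightarrow> 'b::real_normed_vector) \<Rightarrow> ennreal" where
  "variation X n f =
     (SUP (\<omega>, \<upsilon>) \<in> {(\<omega>, \<upsilon>). \<omega> \<in> X \<and> \<upsilon> \<in> X \<and> (\<forall>i<n. \<omega> i = \<upsilon> i)}. ennreal (norm (f \<omega> - f \<upsilon>)))"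

definition lip_seminorm ::
    "real \<Rightarrow> (nat \<Rightarrow> 's) set \<Rightarrow> nat \<Rightarrow> ((nat \<Rightarrow> 's) \<Rightarrow> 'b::real_normed_vector) \<Rightarrow> ennreal" where
  "lip_seminorm \<theta> X k f = (SUP n\<in>{k..}. variation X n f / ennreal (\<theta> ^ n))"

text \<open>
  Functions on \<open>X\<close> are represented by total functions vanishing outside \<open>X\<close>, so that the sets
  below are vector spaces under the pointwise operations and equality of members is equality on
  \<open>X\<close>.
\<close>

definition Cb :: "real \<Rightarrow> (nat \<Rightarrow> 's) set \<Rightarrow> ((nat \<Rightarrow> 's) \<Rightarrow> complex) set" where
  "Cb \<theta> X = {f. continuous_map (top_theta \<theta> X) euclidean f \<and> bounded (f ` X) \<and>
               (\<forall>\<omega>. \<omega> \<notin> X \<longrightarrow> f \<omega> = 0)}"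

definition Fb :: "real \<Rightarrow> (nat \<Rightarrow> 's) set \<Rightarrow> nat \<Rightarrow> ((nat \<Rightarrow> 's) \<Rightarrow> complex) set" where
  "Fb \<theta> X k = {f \<in> Cb \<theta> X. lip_seminorm \<theta> X k f < \<infinity>}"

definition norm_Fb :: "real \<Rightarrow> (nat \<Rightarrow> 's) set \<Rightarrow> nat \<Rightarrow> ((nat \<Rightarrow> 's) \<Rightarrow> complex) \<Rightarrow> real" where
  "norm_Fb \<theta> X k f = (SUP \<omega>\<in>X. norm (f \<omega>)) + enn2real (lip_seminorm \<theta> X k f)"


section \<open>Spectral radius\<close>

text \<open>
  Spectrum of an operator \<open>T\<close> on a space \<open>V\<close> of complex functions with norm \<open>N\<close>: those \<open>z\<close> for
  which \<open>z I - T\<close> has no bounded two-sided inverse \<open>R\<close> on \<open>V\<close> (linearity of \<open>R\<close> is automatic).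
\<close>

definition spectrum_on ::
    "('x \<Rightarrow> complex) set \<Rightarrow> (('x \<Rightarrow> complex) \<Rightarrow> real) \<Rightarrow>
     (('x \<Rightarrow> complex) \<Rightarrow> ('x \<Rightarrow> complex)) \<Rightarrow> complex set" where
  "spectrum_on V N T = {z. \<not> (\<exists>R. (\<forall>f\<in>V. R f \<in> V) \<and>
       (\<forall>f\<in>V. R (\<lambda>x. z * f x - T f x) = f) \<and>
       (\<forall>f\<in>V. (\<lambda>x. z * R f x - T (R f) x) = f) \<and>
       (\<exists>C. \<forall>f\<in>V. N (R f) \<le> C * N f))}"

definition spectral_radius_on ::
    "('x \<Rightarrow> complex) set \<Rightarrow> (('x \<Rightarrow> complex) \<Rightarrow> real) \<Rightarrow>
     (('x \<Rightarrow> complex) \<Rightarrow> ('x \<Rightarrow> complex)) \<Rightarrow> real" where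
  "spectral_radius_on V N T = (SUP z\<in>spectrum_on V N T. norm z)"


section \<open>Thermodynamic formalism\<close>

text \<open>
  Finiteness of each \<open>sup\<^bsub>[s]\<^esub> \<phi>\<close> is part of summability; it has to be stated because \<^const>\<open>Sup\<close>
  on the reals is unspecified for unbounded sets.
\<close>

definition summable_potential :: "(nat \<Rightarrow> 's) set \<Rightarrow> ((nat \<Rightarrow> 's) \<Rightarrow> real) \<Rightarrow> bool" where
  "summable_potential X \<phi> \<longleftrightarrow>
     (\<forall>s. bdd_above (\<phi> ` cylinder X [s])) \<and>
     (\<lambda>s. exp (SUP \<omega>\<in>cylinder X [s]. \<phi> \<omega>)) summable_on {s. cylinder X [s] \<noteq> {}}"

definition birkhoff_sum :: "nat \<Rightarrow> ((nat \<Rightarrow> 's) \<Rightarrow> real) \<Rightarrow> (nat \<Rightarrow> 's) \<Rightarrow> real" where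
  "birkhoff_sum n \<phi> \<omega> = (\<Sum>i<n. \<phi> ((left_shift ^^ i) \<omega>))"

text \<open>
  The pressure of \<open>\<phi>\<close> restricted to a shift-invariant \<open>Y \<subseteq> X\<close>.  For summable \<open>\<phi>\<close> all suprema and
  sums are finite, and by submultiplicativity the limit exists in the reals whenever \<open>Y\<close> is a
  Markov shift with a periodic point.
\<close>

definition pressure :: "(nat \<Rightarrow> 's) set \<Rightarrow> ((nat \<Rightarrow> 's) \<Rightarrow> real) \<Rightarrow> real" where
  "pressure Y \<phi> = lim (\<lambda>n. 1 / real n *
     ln (\<Sum>\<^sub>\<infinity>w\<in>{w. length w = n \<and> cylinder Y w \<noteq> {}}.
           exp (SUP \<omega>\<in>cylinder Y w. birkhoff_sum n \<phi> \<omega>)))"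

definition transfer_op ::
    "('s \<Rightarrow> 's \<Rightarrow> nat) \<Rightarrow> ((nat \<Rightarrow> 's) \<Rightarrow> real) \<Rightarrow> ((nat \<Rightarrow> 's) \<Rightarrow> complex) \<Rightarrow>
     ((nat \<Rightarrow> 's) \<Rightarrow> complex)" where
  "transfer_op A \<phi> f = (\<lambda>\<omega>. if \<omega> \<in> markov_shift UNIV A
     then \<Sum>\<^sub>\<infinity>a\<in>{a. A a (\<omega> 0) = 1}. complex_of_real (exp (\<phi> (prepend a \<omega>))) * f (prepend a \<omega>)
     else 0)"

definition ruelle_triplet ::
    "real \<Rightarrow> ('s \<Rightarrow> 's \<Rightarrow> nat) \<Rightarrow> ((nat \<Rightarrow> 's) \<Rightarrow> real) \<Rightarrow> nat \<Rightarrow>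
     real \<Rightarrow> ((nat \<Rightarrow> 's) \<Rightarrow> real) \<Rightarrow> (nat \<Rightarrow> 's) measure \<Rightarrow> bool" where
  "ruelle_triplet \<theta> A \<phi> k lam h \<nu> \<longleftrightarrow>
     (let X = markov_shift UNIV A; L = transfer_op A \<phi>; hc = (\<lambda>\<omega>. complex_of_real (h \<omega>)) in
       lam = exp (pressure X \<phi>) \<and>
       lam = spectral_radius_on (Fb \<theta> X k) (norm_Fb \<theta> X k) L \<and>
       hc \<in> Fb \<theta> X k \<and> (\<forall>\<omega>\<in>X. 0 \<le> h \<omega>) \<and>
       (\<forall>\<omega>\<in>X. L hc \<omega> = complex_of_real lam * hc \<omega>) \<and>
       prob_space \<nu> \<and> sets \<nu> = sets (borel_theta \<theta> X) \<and>
       (\<forall>f\<in>Cb \<theta> X. (\<integral>\<omega>. L f \<omega> \<partial>\<nu>) = complex_of_real lam * (\<integral>\<omega>. f \<omega> \<partial>\<nu>)) \<and>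
       (\<integral>\<omega>. h \<omega> \<partial>\<nu>) = 1)"


section \<open>The sets of sequences that are \<open>M\<close>-admissible up to a given time\<close>

definition Sigma_M :: "(nat \<Rightarrow> 's) set \<Rightarrow> ('s \<Rightarrow> 's \<Rightarrow> nat) \<Rightarrow> (nat \<Rightarrow> 's) set" where
  "Sigma_M X M = (\<Union>(i, j)\<in>{(i, j). M i j = 1}. cylinder X [i, j])"

definition Sigma_M_upto :: "(nat \<Rightarrow> 's) set \<Rightarrow> ('s \<Rightarrow> 's \<Rightarrow> nat) \<Rightarrow> nat \<Rightarrow> (nat \<Rightarrow> 's) set" where
  "Sigma_M_upto X M n = (\<Inter>i\<le>n. {\<omega> \<in> X. (left_shift ^^ i) \<omega> \<in> Sigma_M X M})"

end

theory Submission
  imports Defs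
begin

text \<open>
  Weight a word \<open>w\<close> by the product over its suffixes \<open>v\<close> of \<open>exp (sup\<^bsub>[v]\<^esub> \<phi>)\<close>, and by \<open>0\<close> if \<open>w\<close> is not
  \<open>M\<close>-admissible.  This weight is submultiplicative, and the exponential growth rate \<open>\<beta>\<close> of its sums
  over words of length \<open>n\<close> bounds both the partition functions of \<open>X\<^sub>M\<close> and \<open>\<lambda>\<^sup>n \<mu>\<^sub>A(\<Sigma>\<^sup>n)\<close> from above,
  because \<open>\<nu>\<^sub>A[w] \<le> \<lambda>\<^bsup>-n\<^esup>\<close> times the weight of \<open>w\<close>.  Words in letters outside a large finite set have
  arbitrarily small growth, so cutting words at the visits to the finitely many remaining letters
  shows that \<open>\<beta>\<close> is already attained, up to \<open>\<epsilon>\<close>, by loops at a single block \<open>a\<close> of length \<open>k\<close>; this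
  also disposes of admissible words that do not extend to points of \<open>X\<^sub>M\<close>.  Such loops
  concatenate freely with bounded distortion, so finitely many loops of equal length give points of
  \<open>X\<^sub>M\<close> and disjoint cylinders inside \<open>\<Sigma>\<^sup>n\<close>, all contained in \<open>[a]\<close>, where irreducibility makes
  \<open>h\<^sub>A\<close> bounded below and \<open>\<nu>\<^sub>A[a]\<close> positive.  Hence \<open>log \<beta>\<close> is the pressure of \<open>X\<^sub>M\<close>, and both
  limits are computed at once.
\<close>

section \<open>Submultiplicative weights on words\<close>

lemma summable_on_boundedI:
  fixes f :: "'a \<Rightarrow> real"
  assumes "\<And>x. x \<in> A \<Longrightarrow> 0 \<le> f x" "\<And>F. finite F \<Longrightarrow> F \<subseteq> A \<Longrightarrow> sum f F \<le> B"
  shows "f summable_on A"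
  by (intro nonneg_bdd_above_summable_on bdd_aboveI2[where M = B]) (use assms in auto)

text \<open>\<open>g\<close> may be many-to-one, as concatenation of words is. Restricting to a set
  \<open>D\<close> of representatives reduces the claim to reindexing along an injective
  map.\<close>

lemma summable_on_image:
  fixes f :: "'b \<Rightarrow> real"
  assumes "(\<lambda>x. f (g x)) summable_on A"
  shows "f summable_on g ` A"
proof -
  obtain D where "D \<subseteq> A" "inj_on g D" "g ` A = g ` D"
    using subset_image_inj[of "g ` A" g A] by auto
  with assms show ?thesis by (auto simp: summable_on_reindex o_def intro: summable_on_subset)
qed

lemma sum_le_infsum_subset:
  fixes f :: "'a \<Rightarrow> real"
  assumes "f summable_on A" "finite F" "F \<subseteq> A" "\<And>x. x \<in> A \<Longrightarrow> 0 \<le> f x"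
  shows "sum f F \<le> infsum f A"
  by (rule finite_sum_le_infsum) (use assms in auto)

lemma sum_prod_list_lists:
  fixes f :: "'a \<Rightarrow> 'b::comm_semiring_1"
  assumes "finite B"
  shows "(\<Sum>xs | set xs \<subseteq> B \<and> length xs = n. prod_list (map f xs)) = (sum f B) ^ n"
proof (induction n)
  case 0
  have "{xs. set xs \<subseteq> B \<and> length xs = 0} = {[]}" by auto
  then show ?case by simp
next
  case (Suc n)
  let ?L = "\<lambda>n. {xs. set xs \<subseteq> B \<and> length xs = n}"
  have eq: "?L (Suc n) = (\<lambda>(x, xs). x # xs) ` (B \<times> ?L n)"
    by (auto simp: image_iff length_Suc_conv)
  have "(\<Sum>xs\<in>?L (Suc n). prod_list (map f xs)) = (\<Sum>(x, xs)\<in>B \<times> ?L n. f x * prod_list (map f xs))"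
    unfolding eq by (subst sum.reindex) (auto simp: inj_on_def case_prod_unfold)
  also have "\<dots> = (\<Sum>x\<in>B. f x * (\<Sum>xs\<in>?L n. prod_list (map f xs)))"
    by (simp add: sum.cartesian_product[symmetric] sum_distrib_left)
  also have "\<dots> = (sum f B) ^ Suc n"
    by (simp add: Suc sum_distrib_right)
  finally show ?case .
qed

text \<open>The letter type stays abstract because the results are applied both to letters of the
  alphabet and to blocks of letters.\<close>

locale submultiplicative_weight =
  fixes W :: "'b list \<Rightarrow> real"
  assumes W_nonneg: "0 \<le> W w"
    and W_Nil: "W [] \<le> 1"
    and W_append: "W (u @ v) \<le> W u * W v"
begin

lemma W_le_prod_list: "W w \<le> prod_list (map (\<lambda>b. W [b]) w)"
proof (induction w)
  case Nil
  then show ?case using W_Nil by simp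
next
  case (Cons b w)
  have "W (b # w) \<le> W [b] * W w" using W_append[of "[b]" w] by simp
  also have "\<dots> \<le> W [b] * prod_list (map (\<lambda>b. W [b]) w)"
    by (intro mult_left_mono Cons W_nonneg)
  finally show ?case by simp
qed

text \<open>A word weighs at most the product of its letter weights. Over the finite set
  \<open>B\<close> of letters occurring in \<open>G\<close>, these products sum to a power of the
  total letter weight by distributivity.\<close>

lemma sum_fixed_length_le:
  assumes "(\<lambda>b. W [b]) summable_on U" "finite G" "G \<subseteq> {w. set w \<subseteq> U \<and> length w = n}"
  shows "sum W G \<le> (infsum (\<lambda>b. W [b]) U) ^ n"
proof -
  define B where "B = (\<Union>w\<in>G. set w)"
  have B: "finite B" "B \<subseteq> U" using assms by (auto simp: B_def)
  have "sum W G \<le> (\<Sum>w\<in>G. prod_list (map (\<lambda>b. W [b]) w))"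
    by (intro sum_mono W_le_prod_list)
  also have "\<dots> \<le> (\<Sum>w | set w \<subseteq> B \<and> length w = n. prod_list (map (\<lambda>b. W [b]) w))"
    using assms B
    by (intro sum_mono2 finite_lists_length_eq) (auto simp: B_def W_nonneg intro!: prod_list_nonneg)
  also have "\<dots> = (\<Sum>b\<in>B. W [b]) ^ n"
    by (rule sum_prod_list_lists[OF B(1)])
  also have "\<dots> \<le> (infsum (\<lambda>b. W [b]) U) ^ n"
    using B assms by (intro power_mono sum_le_infsum_subset sum_nonneg W_nonneg) auto
  finally show ?thesis .
qed

lemma summable_on_fixed_length:
  assumes "(\<lambda>b. W [b]) summable_on UNIV"
  shows "W summable_on {w. length w = n}"
  using sum_fixed_length_le[OF assms]
  by (intro summable_on_boundedI[where B = "infsum (\<lambda>b. W [b]) UNIV ^ n"])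
     (auto simp: W_nonneg)

lemma summable_on_short:
  assumes "(\<lambda>b. W [b]) summable_on UNIV"
  shows "W summable_on {w. length w < n}"
proof (induction n)
  case (Suc n)
  have "{w :: 'b list. length w < Suc n} = {w. length w < n} \<union> {w. length w = n}" by auto
  with Suc summable_on_fixed_length[OF assms, of n] show ?case
    by (simp add: summable_on_union)
qed auto

lemma scale:
  assumes "0 \<le> x"
  shows "submultiplicative_weight (\<lambda>w. W w * x ^ length w)"
proof
  show "W (u @ v) * x ^ length (u @ v) \<le> W u * x ^ length u * (W v * x ^ length v)" for u v
    using mult_right_mono[OF W_append[of u v], of "x ^ length (u @ v)"] assms
    by (simp add: power_add mult_ac)
qed (use assms W_nonneg W_Nil in auto)

text \<open>Grouped by length, the sum is dominated by a geometric series whose ratio is the total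
  letter weight.\<close>

lemma summable_on_words_small:
  assumes "(\<lambda>b. W [b]) summable_on U" "infsum (\<lambda>b. W [b]) U < 1"
  shows "W summable_on {w. set w \<subseteq> U}"
proof (rule summable_on_boundedI[OF W_nonneg])
  fix F assume F: "finite F" "F \<subseteq> {w. set w \<subseteq> U}"
  define e where "e = infsum (\<lambda>b. W [b]) U"
  have e: "0 \<le> e" "e < 1" using assms by (auto simp: e_def W_nonneg intro!: infsum_nonneg)
  define N where "N = Suc (Max (insert 0 (length ` F)))"
  have N: "length w < N" if "w \<in> F" for w
    using that F by (auto simp: N_def less_Suc_eq_le intro!: Max_ge)
  have "sum W F = (\<Sum>n<N. \<Sum>w | w \<in> F \<and> length w = n. W w)"
    using N F by (subst sum.group) auto
  also have "\<dots> \<le> (\<Sum>n<N. e ^ n)"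
    unfolding e_def using F by (intro sum_mono sum_fixed_length_le[OF assms(1)]) auto
  also have "\<dots> \<le> (\<Sum>n. e ^ n)"
    using e by (intro sum_le_suminf summable_geometric) auto
  finally show "sum W F \<le> (\<Sum>n. e ^ n)" .
qed

text \<open>Submultiplicativity dominates the family by a product of two summable families. Distinct
  pairs may give the same word, which \<open>summable_on_image\<close> absorbs.\<close>

lemma summable_on_append:
  assumes "W summable_on P" "W summable_on Q"
  shows "W summable_on {u @ v | u v. u \<in> P \<and> v \<in> Q}"
proof -
  have "(\<lambda>(u, v). W u * W v) summable_on (P \<times> Q)"
    using assms
    by (intro summable_on_SigmaI[where g = "\<lambda>u. W u * infsum W Q"])
       (auto intro!: has_sum_cmult_right summable_on_cmult_left mult_nonneg_nonneg W_nonneg)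
  then have "(\<lambda>p. W (fst p @ snd p)) summable_on (P \<times> Q)"
    by (rule summable_on_comparison_test) (auto simp: W_append W_nonneg)
  moreover have "{u @ v | u v. u \<in> P \<and> v \<in> Q} = (\<lambda>p. fst p @ snd p) ` (P \<times> Q)" by force
  ultimately show ?thesis by (simp add: summable_on_image)
qed

text \<open>
  A word containing the letter \<open>a\<close> factors at the first and the last occurrence of \<open>a\<close>, so
  summability over words that avoid \<open>a\<close> and over words that begin and end with \<open>a\<close> gives
  summability over all words.  This disposes of finitely many letters one by one; words in the
  remaining letters are controlled by a geometric series.
\<close>

lemma summable_on_words_if_loops:
  assumes letters: "(\<lambda>b. W [b]) summable_on UNIV"
    and loops: "\<And>a. W summable_on {l. l \<noteq> [] \<and> hd l = a \<and> last l = a}"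
  shows "W summable_on UNIV"
proof -
  have *: "W summable_on UNIV" if "finite F" "W summable_on {w. set w \<inter> F = {}}" for F
    using that
  proof (induction F rule: finite_induct)
    case empty
    then show ?case by simp
  next
    case (insert a F)
    let ?V = "{w. set w \<inter> insert a F = {}}"
    let ?L = "{l. l \<noteq> [] \<and> hd l = a \<and> last l = a}"
    let ?U = "{u @ l' | u l'. u \<in> ?V \<and> l' \<in> {l @ v | l v. l \<in> ?L \<and> v \<in> ?V}}"
    have "W summable_on ?V \<union> ?U"
      by (intro summable_on_union summable_on_append insert.prems loops)
    moreover have "{w. set w \<inter> F = {}} \<subseteq> ?V \<union> ?U"
    proof
      fix w assume w: "w \<in> {w. set w \<inter> F = {}}"
      show "w \<in> ?V \<union> ?U"
      proof (cases "a \<in> set w")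
        case False
        with w show ?thesis by auto
      next
        case True
        then obtain u z where uz: "w = u @ a # z" "a \<notin> set u"
          by (meson split_list_first)
        have "a \<in> set (a # z)" by simp
        from split_list_last[OF this] obtain y v where yv: "a # z = y @ a # v" "a \<notin> set v"
          by auto
        \<comment> \<open>The middle factor runs from the first to the last occurrence of
          \<open>a\<close>; it is \<open>[a]\<close> itself when \<open>a\<close> occurs only
          once.\<close>
        have "y @ [a] \<in> ?L" using yv by (cases y) auto
        moreover have "w = u @ ((y @ [a]) @ v)" using uz yv by simp
        moreover have "set u \<inter> insert a F = {}" "set v \<inter> insert a F = {}"
          using w uz yv \<open>w = u @ ((y @ [a]) @ v)\<close> by auto
        ultimately show ?thesis by blast
      qed
    qed
    ultimately have "W summable_on {w. set w \<inter> F = {}}"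
      by (rule summable_on_subset)
    then show ?case by (rule insert.IH)
  qed
  \<comment> \<open>The letters outside \<open>F\<close> together weigh at most one half, hence less
    than \<open>1\<close>, as the geometric series requires.\<close>
  obtain F where F: "finite F" "dist (\<Sum>b\<in>F. W [b]) (\<Sum>\<^sub>\<infinity>b. W [b]) \<le> 1/2"
    using infsum_finite_approximation[OF letters, of "1/2"] by auto
  have "(\<Sum>\<^sub>\<infinity>b. W [b]) = (\<Sum>\<^sub>\<infinity>b\<in>F. W [b]) + (\<Sum>\<^sub>\<infinity>b\<in>-F. W [b])"
    using letters infsum_Un_disjoint[of "\<lambda>b. W [b]" F "-F"]
    by (auto simp: F intro: summable_on_subset)
  with F have "(\<Sum>\<^sub>\<infinity>b\<in>-F. W [b]) < 1" by (auto simp: dist_real_def)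
  then have "W summable_on {w. set w \<subseteq> -F}"
    by (intro summable_on_words_small summable_on_subset[OF letters]) auto
  moreover have "{w. set w \<subseteq> -F} = {w. set w \<inter> F = {}}" by auto
  ultimately show ?thesis using *[OF F(1)] by simp
qed

end

text \<open>Multiplicative constants vanish after taking logarithms and dividing by
  \<open>n\<close>, so exponential bounds at all rates on either side of \<open>\<beta>\<close>
  squeeze the limit. This serves both the partition functions and the measures.\<close>

lemma growth_rate_tendsto:
  fixes x :: "nat \<Rightarrow> real"
  assumes "0 < \<beta>"
    and upper: "\<And>r. r > \<beta> \<Longrightarrow> \<exists>C>0. \<forall>n. x n \<le> C * r ^ n"
    and lower: "\<And>r. 0 < r \<Longrightarrow> r < \<beta> \<Longrightarrow> \<exists>c>0. \<forall>n. c * r ^ n \<le> x n"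
  shows "(\<lambda>n. 1 / real n * ln (x n)) \<longlonglongrightarrow> ln \<beta>"
proof -
  have pos: "x n > 0" for n
  proof -
    obtain c where "c > 0" "c * (\<beta> / 2) ^ n \<le> x n"
      using lower[of "\<beta> / 2"] assms(1) by auto
    moreover have "c * (\<beta> / 2) ^ n > 0" using \<open>c > 0\<close> assms(1) by simp
    ultimately show ?thesis by linarith
  qed
  have lim: "(\<lambda>n. 1 / real n * c + r) \<longlonglongrightarrow> r" for c r :: real
    by real_asymp
  \<comment> \<open>Positivity of \<open>n\<close> matters: at \<open>n = 0\<close> the left side is
    \<open>0\<close>, because division by zero gives \<open>0\<close>.\<close>
  have eq: "1 / real n * ln (C * r ^ n) = 1 / real n * ln C + ln r" if "C > 0" "r > 0" "n > 0" for C r n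
    using that by (simp add: ln_mult_pos ln_realpow field_simps)
  show ?thesis
  proof (rule order_tendstoI)
    fix a assume a: "a < ln \<beta>"
    obtain b where b: "a < b" "b < ln \<beta>" using a dense by blast
    then have "exp b < \<beta>" using assms(1) by (metis exp_less_cancel_iff exp_ln)
    then obtain c where c: "c > 0" "\<And>n. c * exp b ^ n \<le> x n" using lower[of "exp b"] by auto
    have "eventually (\<lambda>n. a < 1 / real n * ln c + b) sequentially"
      using order_tendstoD(1)[OF lim[of "ln c" b] b(1)] .
    then show "eventually (\<lambda>n. a < 1 / real n * ln (x n)) sequentially"
      using eventually_gt_at_top[of 0]
    proof eventually_elim
      case (elim n)
      have "1 / real n * ln c + b = 1 / real n * ln (c * exp b ^ n)" using c elim eq[of c "exp b" n] by simp
      also have "\<dots> \<le> 1 / real n * ln (x n)"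
        using c pos by (intro mult_left_mono) (auto intro!: ln_mono)
      finally show ?case using elim by simp
    qed
  next
    fix a assume a: "a > ln \<beta>"
    obtain b where b: "a > b" "b > ln \<beta>" using a dense by blast
    then have "exp b > \<beta>" using assms(1) by (metis exp_less_cancel_iff exp_ln)
    then obtain c where c: "c > 0" "\<And>n. c * exp b ^ n \<ge> x n" using upper[of "exp b"] by auto
    have "eventually (\<lambda>n. a > 1 / real n * ln c + b) sequentially"
      using order_tendstoD(2)[OF lim[of "ln c" b] b(1)] .
    then show "eventually (\<lambda>n. a > 1 / real n * ln (x n)) sequentially"
      using eventually_gt_at_top[of 0]
    proof eventually_elim
      case (elim n)
      have "1 / real n * ln (x n) \<le> 1 / real n * ln (c * exp b ^ n)"
        using c pos by (intro mult_left_mono) (auto intro!: ln_mono)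
      also have "\<dots> = 1 / real n * ln c + b" using c elim eq[of c "exp b" n] by simp
      finally show ?case using elim by simp
    qed
  qed
qed

text \<open>At most \<open>N\<close> factors are dropped, each at most \<open>max 1 r\<close>. This
  carries bounds along multiples of a loop length \<open>N\<close> over to every time
  \<open>n\<close>.\<close>

lemma power_le_max_power_mult:
  fixes r :: real
  assumes "0 < r" "n div N * N \<le> m" "m \<le> n" "0 < N"
  shows "r ^ n \<le> max 1 r ^ N * r ^ m"
proof -
  have "r ^ n = r ^ (n - m) * r ^ m" using assms by (simp flip: power_add)
  also have "r ^ (n - m) \<le> max 1 r ^ (n - m)" using assms by (intro power_mono) auto
  also have "\<dots> \<le> max 1 r ^ N"
    using assms div_mult_mod_eq[of n N] mod_less_divisor[of N n]
    by (intro power_increasing) linarith+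
  finally show ?thesis using assms by simp
qed

section \<open>Shifts, cylinders and Birkhoff sums\<close>

lemma left_shift_funpow: "(left_shift ^^ n) \<omega> = (\<lambda>i. \<omega> (n + i))"
  by (induction n arbitrary: \<omega>) (auto simp: left_shift_def funpow_Suc_right simp del: funpow.simps(2))

lemma left_shift_in_markov_shift: "\<omega> \<in> markov_shift S A \<Longrightarrow> (left_shift ^^ n) \<omega> \<in> markov_shift S A"
  by (auto simp: markov_shift_def left_shift_funpow)

lemma birkhoff_sum_add:
  "birkhoff_sum (m + n) \<phi> \<omega> = birkhoff_sum m \<phi> \<omega> + birkhoff_sum n \<phi> ((left_shift ^^ m) \<omega>)"
proof -
  have eq: "{..<m + n} = {..<m} \<union> (\<lambda>i. m + i) ` {..<n}"
  proof (intro equalityI subsetI)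
    fix x assume "x \<in> {..<m + n}"
    then show "x \<in> {..<m} \<union> (\<lambda>i. m + i) ` {..<n}"
      by (cases "x < m") (auto intro!: image_eqI[where x = "x - m"])
  qed auto
  show ?thesis unfolding birkhoff_sum_def eq
    by (subst sum.union_disjoint) (auto simp: sum.reindex left_shift_funpow add.assoc)
qed

lemma cylinder_Nil [simp]: "cylinder X [] = X"
  by (simp add: cylinder_def)

lemma cylinder_append:
  assumes "X = markov_shift S A"
  shows "\<omega> \<in> cylinder X (u @ v) \<longleftrightarrow> \<omega> \<in> cylinder X u \<and> (left_shift ^^ length u) \<omega> \<in> cylinder X v"
proof
  assume *: "\<omega> \<in> cylinder X (u @ v)"
  then have "\<omega> i = (u @ v) ! i" if "i < length u + length v" for i
    using that by (auto simp: cylinder_def)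
  note this[of "length u + _"] this
  with * show "\<omega> \<in> cylinder X u \<and> (left_shift ^^ length u) \<omega> \<in> cylinder X v"
    using left_shift_in_markov_shift[of \<omega> S A "length u"]
    by (auto simp: cylinder_def left_shift_funpow assms nth_append)
next
  assume *: "\<omega> \<in> cylinder X u \<and> (left_shift ^^ length u) \<omega> \<in> cylinder X v"
  have "\<omega> i = (u @ v) ! i" if "i < length u + length v" for i
  proof (cases "i < length u")
    case False
    then obtain j where "i = length u + j" using le_Suc_ex not_less by blast
    with * that show ?thesis by (auto simp: cylinder_def left_shift_funpow)
  qed (use * in \<open>auto simp: cylinder_def nth_append\<close>)
  with * show "\<omega> \<in> cylinder X (u @ v)" by (auto simp: cylinder_def)
qed

lemma cylinder_append_subset: "cylinder X (u @ v) \<subseteq> cylinder X u"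
  by (auto simp: cylinder_def nth_append)

lemma cylinder_agree:
  "\<omega> \<in> cylinder X w \<Longrightarrow> \<upsilon> \<in> cylinder X w \<Longrightarrow> i < length w \<Longrightarrow> \<omega> i = \<upsilon> i"
  by (simp add: cylinder_def)

lemma cylinder_disjoint:
  assumes "length u = length v" "u \<noteq> v"
  shows "cylinder X u \<inter> cylinder X v = {}"
  using assms by (auto simp: cylinder_def) (metis nth_equalityI)

lemma mem_cylinder_prefix: "\<omega> \<in> X \<Longrightarrow> \<omega> \<in> cylinder X (map \<omega> [0..<n])"
  by (simp add: cylinder_def)

lemma successively_prefix:
  "\<omega> \<in> markov_shift S A \<Longrightarrow> successively (\<lambda>i j. A i j = 1) (map \<omega> [0..<n])"
  by (auto simp: successively_conv_nth markov_shift_def)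

text \<open>Extracts one real constant valid at all scales from \<open>k\<close> on, so that later
  estimates take place in the reals.\<close>

lemma lip_seminorm_finiteD:
  fixes f :: "(nat \<Rightarrow> 's) \<Rightarrow> 'b::real_normed_vector"
  assumes "0 < \<theta>" "lip_seminorm \<theta> X k f < \<infinity>"
  obtains C where "0 \<le> C"
    "\<And>n \<omega> \<upsilon>. k \<le> n \<Longrightarrow> \<omega> \<in> X \<Longrightarrow> \<upsilon> \<in> X \<Longrightarrow> (\<And>i. i < n \<Longrightarrow> \<omega> i = \<upsilon> i) \<Longrightarrow>
       norm (f \<omega> - f \<upsilon>) \<le> C * \<theta> ^ n"
proof -
  obtain C where C: "0 \<le> C" "lip_seminorm \<theta> X k f = ennreal C"
    using assms(2) by (cases "lip_seminorm \<theta> X k f") auto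
  show ?thesis
  proof (rule that[OF C(1)])
    fix n \<omega> \<upsilon> assume *: "k \<le> n" "\<omega> \<in> X" "\<upsilon> \<in> X" "\<And>i. i < n \<Longrightarrow> \<omega> i = \<upsilon> i"
    have "ennreal (norm (f \<omega> - f \<upsilon>)) \<le> variation X n f"
      unfolding variation_def using * by (intro SUP_upper2[where i = "(\<omega>, \<upsilon>)"]) auto
    moreover have "variation X n f / ennreal (\<theta> ^ n) \<le> ennreal C"
      unfolding C(2)[symmetric] lip_seminorm_def using * by (intro SUP_upper) auto
    \<comment> \<open>The variation cannot be infinite here, since infinity divided by a finite
      number is infinity.\<close>
    then have "variation X n f \<le> ennreal C * ennreal (\<theta> ^ n)"
      using assms(1) C(1)
      by (cases "variation X n f")
         (auto simp: divide_ennreal divide_le_eq ennreal_mult[symmetric] top_unique ennreal_top_divide)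
    ultimately have "ennreal (norm (f \<omega> - f \<upsilon>)) \<le> ennreal (C * \<theta> ^ n)"
      using C assms(1) by (simp add: ennreal_mult)
    then show "norm (f \<omega> - f \<upsilon>) \<le> C * \<theta> ^ n"
      using C assms(1) by (simp add: ennreal_le_iff)
  qed
qed

lemma birkhoff_sum_Suc: "birkhoff_sum (Suc n) \<phi> \<omega> = \<phi> \<omega> + birkhoff_sum n \<phi> (left_shift \<omega>)"
  using birkhoff_sum_add[of 1 n \<phi> \<omega>] by (simp add: birkhoff_sum_def)

lemma birkhoff_sum_le:
  assumes "\<And>i. \<phi> ((left_shift ^^ i) \<omega>) \<le> c"
  shows "birkhoff_sum n \<phi> \<omega> \<le> real n * c"
  unfolding birkhoff_sum_def using sum_bounded_above[of "{..<n}" _ c] assms by simp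

section \<open>Weights of words and their growth rate\<close>

text \<open>Each factor takes its supremum over the cylinder of the whole remaining suffix, so one
  application of the transfer operator removes exactly one factor. For an empty cylinder the factor
  is the exponential of an unspecified real, hence still positive.\<close>

fun sup_weight :: "(nat \<Rightarrow> 's) set \<Rightarrow> ((nat \<Rightarrow> 's) \<Rightarrow> real) \<Rightarrow> 's list \<Rightarrow> real" where
  "sup_weight X \<phi> [] = 1"
| "sup_weight X \<phi> (b # v) = exp (SUP \<omega>\<in>cylinder X (b # v). \<phi> \<omega>) * sup_weight X \<phi> v"

lemma sup_weight_pos [simp]: "0 < sup_weight X \<phi> w"
  by (induction w) auto

locale markov_potential =
  fixes A M :: "'s \<Rightarrow> 's \<Rightarrow> nat" and S\<^sub>0 :: "'s set"
    and \<theta> :: real and \<phi> :: "(nat \<Rightarrow> 's) \<Rightarrow> real" and k :: nat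
  assumes theta: "0 < \<theta>" "\<theta> < 1"
    and M_imp_A: "\<And>i j. M i j = 1 \<Longrightarrow> A i j = 1"
    and M_imp_S0: "\<And>i j. M i j = 1 \<Longrightarrow> i \<in> S\<^sub>0 \<and> j \<in> S\<^sub>0"
    and irreducible: "irreducible_matrix A"
    and periodic: "has_periodic_point (markov_shift S\<^sub>0 M)"
    and k_pos: "1 \<le> k"
    and summable: "summable_potential (markov_shift UNIV A) \<phi>"
    and lipschitz: "lip_seminorm \<theta> (markov_shift UNIV A) (k + 1) \<phi> < \<infinity>"
begin

definition "X = markov_shift UNIV A"
definition "Y = markov_shift S\<^sub>0 M"
abbreviation "cyl \<equiv> cylinder X"
abbreviation "wt \<equiv> sup_weight X \<phi>"

lemma Y_subset_X: "Y \<subseteq> X"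
  using M_imp_A by (auto simp: X_def Y_def markov_shift_def)

lemma shift_X: "\<omega> \<in> X \<Longrightarrow> (left_shift ^^ n) \<omega> \<in> X"
  unfolding X_def by (rule left_shift_in_markov_shift)

lemma cyl_append:
  "\<omega> \<in> cyl (u @ v) \<longleftrightarrow> \<omega> \<in> cyl u \<and> (left_shift ^^ length u) \<omega> \<in> cyl v"
  by (rule cylinder_append[OF X_def])

lemma cyl_Cons: "\<omega> \<in> cyl (b # v) \<longleftrightarrow> \<omega> \<in> cyl [b] \<and> left_shift \<omega> \<in> cyl v"
  using cyl_append[of \<omega> "[b]" v] by simp

lemma cyl_in_X: "\<omega> \<in> cyl w \<Longrightarrow> \<omega> \<in> X"
  by (simp add: cylinder_def)

lemma bdd_above_cyl: "bdd_above (\<phi> ` cyl (b # v))"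
proof (rule bdd_above_mono)
  show "bdd_above (\<phi> ` cyl [b])"
    using summable by (simp add: summable_potential_def X_def)
  show "\<phi> ` cyl (b # v) \<subseteq> \<phi> ` cyl [b]"
    using cylinder_append_subset[of X "[b]" v] by auto
qed

definition lip_const :: real where
  "lip_const = (SOME C. 0 \<le> C \<and> (\<forall>n \<omega> \<upsilon>. k + 1 \<le> n \<longrightarrow> \<omega> \<in> X \<longrightarrow> \<upsilon> \<in> X \<longrightarrow>
     (\<forall>i<n. \<omega> i = \<upsilon> i) \<longrightarrow> \<bar>\<phi> \<omega> - \<phi> \<upsilon>\<bar> \<le> C * \<theta> ^ n))"

lemma
  shows lip_const_nonneg: "0 \<le> lip_const"
    and phi_variation: "k + 1 \<le> n \<Longrightarrow> \<omega> \<in> X \<Longrightarrow> \<upsilon> \<in> X \<Longrightarrow> (\<And>i. i < n \<Longrightarrow> \<omega> i = \<upsilon> i) \<Longrightarrow>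
       \<bar>\<phi> \<omega> - \<phi> \<upsilon>\<bar> \<le> lip_const * \<theta> ^ n"
proof -
  obtain C where "0 \<le> C \<and> (\<forall>n \<omega> \<upsilon>. k + 1 \<le> n \<longrightarrow> \<omega> \<in> X \<longrightarrow> \<upsilon> \<in> X \<longrightarrow>
     (\<forall>i<n. \<omega> i = \<upsilon> i) \<longrightarrow> \<bar>\<phi> \<omega> - \<phi> \<upsilon>\<bar> \<le> C * \<theta> ^ n)"
    using lip_seminorm_finiteD[OF theta(1) lipschitz] unfolding X_def real_norm_def by metis
  then have *: "0 \<le> lip_const \<and> (\<forall>n \<omega> \<upsilon>. k + 1 \<le> n \<longrightarrow> \<omega> \<in> X \<longrightarrow> \<upsilon> \<in> X \<longrightarrow>
     (\<forall>i<n. \<omega> i = \<upsilon> i) \<longrightarrow> \<bar>\<phi> \<omega> - \<phi> \<upsilon>\<bar> \<le> lip_const * \<theta> ^ n)"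
    unfolding lip_const_def by (rule someI)
  then show "0 \<le> lip_const" by blast
  show "k + 1 \<le> n \<Longrightarrow> \<omega> \<in> X \<Longrightarrow> \<upsilon> \<in> X \<Longrightarrow> (\<And>i. i < n \<Longrightarrow> \<omega> i = \<upsilon> i) \<Longrightarrow>
       \<bar>\<phi> \<omega> - \<phi> \<upsilon>\<bar> \<le> lip_const * \<theta> ^ n" for n \<omega> \<upsilon>
    using * by blast
qed

text \<open>Two points that agree on \<open>n + k\<close> places have Birkhoff sums of length
  \<open>n\<close> differing by at most this amount: the summand with \<open>i\<close> further
  summands after it sees at least \<open>k + 1 + i\<close> common letters. The geometric series
  makes the bound uniform in \<open>n\<close>.\<close>

definition "distortion n = (\<Sum>i<n. lip_const * \<theta> ^ (k + 1 + i))"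
definition "max_distortion = lip_const / (1 - \<theta>)"

lemma distortion_le: "distortion n \<le> max_distortion"
proof -
  have "distortion n \<le> (\<Sum>i<n. lip_const * \<theta> ^ i)"
    unfolding distortion_def using theta
    by (intro sum_mono mult_left_mono power_decreasing lip_const_nonneg) auto
  also have "\<dots> = lip_const * (\<Sum>i<n. \<theta> ^ i)" by (simp add: sum_distrib_left)
  also have "\<dots> \<le> lip_const * (\<Sum>i. \<theta> ^ i)"
    using theta by (intro mult_left_mono sum_le_suminf summable_geometric lip_const_nonneg) auto
  also have "\<dots> = max_distortion"
    using theta by (simp add: suminf_geometric max_distortion_def)
  finally show ?thesis .
qed

lemma max_distortion_nonneg: "0 \<le> max_distortion"
  using lip_const_nonneg theta by (simp add: max_distortion_def)

lemma exp_birkhoff_le_wt: "\<omega> \<in> cyl w \<Longrightarrow> exp (birkhoff_sum (length w) \<phi> \<omega>) \<le> wt w"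
proof (induction w arbitrary: \<omega>)
  case Nil
  then show ?case by (simp add: birkhoff_sum_def)
next
  case (Cons b w)
  have "left_shift \<omega> \<in> cyl w" using Cons.prems cyl_Cons by blast
  then have "exp (birkhoff_sum (length w) \<phi> (left_shift \<omega>)) \<le> wt w" by (rule Cons.IH)
  moreover have "\<phi> \<omega> \<le> (SUP \<omega>\<in>cyl (b # w). \<phi> \<omega>)"
    by (intro cSUP_upper Cons.prems bdd_above_cyl)
  ultimately show ?case by (auto simp: birkhoff_sum_Suc exp_add intro!: mult_mono)
qed

text \<open>Lengthening the word shrinks the cylinders over which the suprema for \<open>u\<close>
  run; nonemptiness keeps the real suprema comparable.\<close>

lemma wt_append:
  assumes "cyl (u @ v) \<noteq> {}"
  shows "wt (u @ v) \<le> wt u * wt v"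
  using assms
proof (induction u)
  case (Cons b u)
  have ne: "cyl (b # u @ v) \<noteq> {}" using Cons.prems by simp
  then have "cyl (u @ v) \<noteq> {}" using cyl_Cons by blast
  then have "wt (u @ v) \<le> wt u * wt v" by (rule Cons.IH)
  moreover have "(SUP \<omega>\<in>cyl (b # u @ v). \<phi> \<omega>) \<le> (SUP \<omega>\<in>cyl (b # u). \<phi> \<omega>)"
    using ne cylinder_append_subset[of X "b # u" v] by (intro cSUP_subset_mono bdd_above_cyl) auto
  ultimately show ?case
    by (auto intro!: mult_mono simp: mult.assoc intro: less_imp_le)
qed simp

text \<open>The block \<open>v\<close> of length at least \<open>k\<close> ensures that every
  supremum coming from \<open>u\<close> runs over a cylinder of length at least
  \<open>k + 1\<close>, where the variation of \<open>\<phi>\<close> is controlled. Weights are thus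
  Birkhoff sums up to bounded distortion.\<close>

lemma wt_le_exp_birkhoff:
  assumes "\<omega> \<in> cyl (u @ v)" "k \<le> length v"
  shows "wt (u @ v) \<le> exp (birkhoff_sum (length u) \<phi> \<omega> + distortion (length u)) * wt v"
  using assms(1)
proof (induction u arbitrary: \<omega>)
  case Nil
  then show ?case by (simp add: birkhoff_sum_def distortion_def)
next
  case (Cons b u)
  have "left_shift \<omega> \<in> cyl (u @ v)" using Cons.prems cyl_Cons[of \<omega> b "u @ v"] by simp
  then have IH: "wt (u @ v) \<le> exp (birkhoff_sum (length u) \<phi> (left_shift \<omega>) + distortion (length u)) * wt v"
    by (rule Cons.IH)
  have "(SUP \<omega>\<in>cyl (b # u @ v). \<phi> \<omega>) \<le> \<phi> \<omega> + lip_const * \<theta> ^ (k + 1 + length u)"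
  proof (rule cSUP_least)
    fix \<upsilon> assume "\<upsilon> \<in> cyl (b # u @ v)"
    moreover have "\<omega> \<in> cyl (b # u @ v)" using Cons.prems by simp
    ultimately have "\<bar>\<phi> \<upsilon> - \<phi> \<omega>\<bar> \<le> lip_const * \<theta> ^ (k + 1 + length u)"
      using assms(2) by (intro phi_variation) (auto intro: cyl_in_X cylinder_agree)
    then show "\<phi> \<upsilon> \<le> \<phi> \<omega> + lip_const * \<theta> ^ (k + 1 + length u)" by linarith
  qed (use Cons.prems in auto)
  then have "wt ((b # u) @ v) \<le> exp (\<phi> \<omega> + lip_const * \<theta> ^ (k + 1 + length u)) *
     (exp (birkhoff_sum (length u) \<phi> (left_shift \<omega>) + distortion (length u)) * wt v)"
    using IH by (auto intro!: mult_mono intro: less_imp_le)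
  also have "\<dots> = exp (birkhoff_sum (length (b # u)) \<phi> \<omega> + distortion (length (b # u))) * wt v"
    by (simp add: birkhoff_sum_Suc distortion_def exp_add mult_ac)
  finally show ?case .
qed

abbreviation "admissible \<equiv> successively (\<lambda>i j. M i j = 1)"

text \<open>Nonemptiness refers to the cylinder in \<open>X\<close>, not in \<open>Y\<close>:
  admissible words that are dead ends for \<open>M\<close> still carry weight, as they do in the
  measure of the admissible set.\<close>

definition "WM w = (if admissible w \<and> cyl w \<noteq> {} then wt w else 0)"

sublocale WM: submultiplicative_weight WM
proof
  show "0 \<le> WM w" for w by (simp add: WM_def less_imp_le)
  show "WM [] \<le> 1" by (simp add: WM_def)
  show "WM (u @ v) \<le> WM u * WM v" for u v
  proof (cases "admissible (u @ v) \<and> cyl (u @ v) \<noteq> {}")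
    case True
    then have "cyl u \<noteq> {}" "cyl v \<noteq> {}" using cyl_append by blast+
    with True wt_append[of u v] show ?thesis by (auto simp: WM_def successively_append_iff)
  next
    case False
    then have "WM (u @ v) = 0" by (auto simp: WM_def)
    then show ?thesis by (simp add: WM_def less_imp_le)
  qed
qed

lemma summable_letters: "(\<lambda>b. WM [b]) summable_on UNIV"
proof -
  have "(\<lambda>s. exp (SUP \<omega>\<in>cyl [s]. \<phi> \<omega>)) summable_on {s. cyl [s] \<noteq> {}}"
    using summable by (simp add: summable_potential_def X_def)
  also have "?this \<longleftrightarrow> (\<lambda>b. WM [b]) summable_on UNIV"
    by (rule summable_on_cong_neutral) (auto simp: WM_def)
  finally show ?thesis .
qed

text \<open>The total letter weight bounds each single letter weight, hence
  \<open>exp (\<phi> \<omega>)\<close> uniformly. A nonnegative bound lets a number of steps be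
  replaced by a larger one later.\<close>

lemma phi_bounded_above: obtains c where "0 \<le> c" "\<And>\<omega>. \<omega> \<in> X \<Longrightarrow> \<phi> \<omega> \<le> c"
proof -
  define K where "K = (\<Sum>\<^sub>\<infinity>b. WM [b])"
  have "exp (\<phi> \<omega>) \<le> K" if "\<omega> \<in> X" for \<omega>
  proof -
    have *: "\<omega> \<in> cyl [\<omega> 0]" using that by (simp add: cylinder_def)
    have "exp (\<phi> \<omega>) \<le> wt [\<omega> 0]"
      using exp_birkhoff_le_wt[OF *] by (simp add: birkhoff_sum_def)
    also have "\<dots> = (\<Sum>b\<in>{\<omega> 0}. WM [b])" using * by (auto simp: WM_def)
    also have "\<dots> \<le> K" unfolding K_def
      by (rule sum_le_infsum_subset[OF summable_letters]) (auto simp: WM.W_nonneg)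
    finally show ?thesis .
  qed
  then have "\<phi> \<omega> \<le> ln (max 1 K)" if "\<omega> \<in> X" for \<omega>
    using that by (subst ln_ge_iff) (auto simp: le_max_iff_disj)
  then show ?thesis by (intro that[of "ln (max 1 K)"]) auto
qed

section \<open>The critical exponent of the weighted word series\<close>

definition "rates = {r. 0 < r \<and> (\<lambda>w. WM w * (1 / r) ^ length w) summable_on UNIV}"
text \<open>The series of \<open>WM\<close> over words, graded by length, has radius of convergence
  \<open>1 / growth_rate\<close>. Defining the rate through convergence makes divergence at every
  smaller positive \<open>r\<close> immediate.\<close>

definition "growth_rate = Inf rates"

lemma scaled: "0 < r \<Longrightarrow> submultiplicative_weight (\<lambda>w. WM w * (1 / r) ^ length w)"
  by (rule WM.scale) simp

text \<open>Scaling by \<open>1 / (K + 1)\<close> brings the total letter weight \<open>K\<close>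
  down to \<open>K / (K + 1)\<close>, which is below \<open>1\<close>.\<close>

lemma rates_nonempty: "rates \<noteq> {}"
proof -
  define K where "K = (\<Sum>\<^sub>\<infinity>b. WM [b])"
  have K: "0 \<le> K" by (auto simp: K_def WM.W_nonneg intro!: infsum_nonneg)
  interpret V: submultiplicative_weight "\<lambda>w. WM w * (1 / (K + 1)) ^ length w"
    using K by (intro scaled) auto
  have "(\<lambda>w. WM w * (1 / (K + 1)) ^ length w) summable_on {w. set w \<subseteq> UNIV}"
  proof (rule V.summable_on_words_small)
    show "(\<lambda>b. WM [b] * (1 / (K + 1)) ^ length [b]) summable_on UNIV"
      using summable_on_cmult_left[OF summable_letters, of "1 / (K + 1)"] by simp
    have "(\<Sum>\<^sub>\<infinity>b. WM [b] * (1 / (K + 1)) ^ length [b]) = K * (1 / (K + 1))"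
      using infsum_cmult_left'[of "\<lambda>b. WM [b]" "1 / (K + 1)" UNIV] by (simp add: K_def)
    also have "\<dots> < 1" using K by simp
    finally show "(\<Sum>\<^sub>\<infinity>b. WM [b] * (1 / (K + 1)) ^ length [b]) < 1" .
  qed
  then have "K + 1 \<in> rates" using K by (simp add: rates_def)
  then show ?thesis by blast
qed

text \<open>The prefixes of a periodic point of \<open>Y\<close> supply one word of each length
  \<open>n\<close> with weight at least \<open>exp c ^ n\<close>, where \<open>c\<close> is the
  minimum of \<open>\<phi>\<close> on the orbit. At rates below \<open>exp c\<close> the terms are
  unbounded.\<close>

lemma rates_lower_bound: obtains c where "0 < c" "\<And>r. r \<in> rates \<Longrightarrow> c \<le> r"
proof -
  obtain \<omega> p where \<omega>: "\<omega> \<in> Y" "1 \<le> p" "(left_shift ^^ p) \<omega> = \<omega>"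
    using periodic by (auto simp: has_periodic_point_def Y_def)
  have X: "\<omega> \<in> X" using \<omega> Y_subset_X by blast
  have per: "(left_shift ^^ i) \<omega> = (left_shift ^^ (i mod p)) \<omega>" for i
    using funpow_mod_eq[OF \<omega>(3), of i] by simp
  define c where "c = Min ((\<lambda>i. \<phi> ((left_shift ^^ i) \<omega>)) ` {..<p})"
  have c: "c \<le> \<phi> ((left_shift ^^ i) \<omega>)" for i
    unfolding c_def per[of i] using \<omega>(2) by (intro Min_le) auto
  have WM: "exp c ^ n \<le> WM (map \<omega> [0..<n])" for n
  proof -
    have "real n * c \<le> birkhoff_sum n \<phi> \<omega>"
      unfolding birkhoff_sum_def using sum_bounded_below[of "{..<n}" c] c by simp
    then have "exp c ^ n \<le> exp (birkhoff_sum n \<phi> \<omega>)" by (simp add: exp_of_nat_mult[symmetric])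
    also have "\<dots> \<le> wt (map \<omega> [0..<n])"
      using exp_birkhoff_le_wt[OF mem_cylinder_prefix[OF X, of n]] by simp
    also have "\<dots> = WM (map \<omega> [0..<n])"
      using \<omega>(1) mem_cylinder_prefix[OF X, of n] successively_prefix[of \<omega> S\<^sub>0 M n]
      by (auto simp: WM_def Y_def)
    finally show ?thesis .
  qed
  show ?thesis
  proof (rule that[of "exp c"])
    fix r assume "r \<in> rates"
    then have r: "0 < r" and sm: "(\<lambda>w. WM w * (1 / r) ^ length w) summable_on UNIV"
      by (auto simp: rates_def)
    show "exp c \<le> r"
    proof (rule ccontr)
      assume "\<not> exp c \<le> r"
      then have 1: "1 < exp c / r" using r by simp
      define B where "B = (\<Sum>\<^sub>\<infinity>w. WM w * (1 / r) ^ length w)"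
      have "(exp c / r) ^ n \<le> B" for n
      proof -
        have "(exp c / r) ^ n \<le> (\<Sum>w\<in>{map \<omega> [0..<n]}. WM w * (1 / r) ^ length w)"
          using WM[of n] r by (simp add: power_divide divide_right_mono)
        also have "\<dots> \<le> B" unfolding B_def using r
          by (intro sum_le_infsum_subset[OF sm]) (auto simp: WM.W_nonneg)
        finally show ?thesis .
      qed
      moreover obtain n where "B < (exp c / r) ^ n" using 1 real_arch_pow by blast
      ultimately show False by (meson not_less)
    qed
  qed simp
qed

lemma growth_rate_pos: "0 < growth_rate"
proof -
  obtain c where c: "0 < c" "\<And>r. r \<in> rates \<Longrightarrow> c \<le> r" using rates_lower_bound by blast
  then have "c \<le> growth_rate" unfolding growth_rate_def by (intro cInf_greatest rates_nonempty)
  with c(1) show ?thesis by linarith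
qed

lemma bdd_below_rates: "bdd_below rates"
  by (rule bdd_belowI[of _ 0]) (auto simp: rates_def)

text \<open>At a rate \<open>q\<close> below \<open>r\<close> the whole series converges to some
  \<open>B\<close>, so its part of length \<open>n\<close> gives at most \<open>B * q ^ n\<close>.
  Passing to \<open>B + 1\<close> makes the constant positive.\<close>

lemma sum_WM_upper:
  assumes "growth_rate < r"
  obtains C where "0 < C" "\<And>n F. finite F \<Longrightarrow> F \<subseteq> {w. length w = n} \<Longrightarrow> sum WM F \<le> C * r ^ n"
proof -
  obtain q where q: "q \<in> rates" "q < r"
    using assms rates_nonempty bdd_below_rates unfolding growth_rate_def
    by (metis cInf_less_iff)
  then have pos: "0 < q" and sm: "(\<lambda>w. WM w * (1 / q) ^ length w) summable_on UNIV"
    by (auto simp: rates_def)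
  define B where "B = (\<Sum>\<^sub>\<infinity>w. WM w * (1 / q) ^ length w)"
  have "sum WM F \<le> B * q ^ n" if "finite F" "F \<subseteq> {w. length w = n}" for F n
  proof -
    have "(\<Sum>w\<in>F. WM w) * (1 / q) ^ n = (\<Sum>w\<in>F. WM w * (1 / q) ^ length w)"
      using that by (auto simp: sum_distrib_right intro!: sum.cong)
    also have "\<dots> \<le> B" unfolding B_def using that pos
      by (intro sum_le_infsum_subset[OF sm]) (auto simp: WM.W_nonneg)
    finally show ?thesis using pos by (simp add: field_simps)
  qed
  moreover have "B * q ^ n \<le> (B + 1) * r ^ n" for n
    using q pos unfolding B_def
    by (intro mult_mono power_mono) (auto simp: WM.W_nonneg intro!: infsum_nonneg add_nonneg_nonneg)
  moreover have "0 < B + 1" unfolding B_def using pos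
    by (intro add_nonneg_pos infsum_nonneg) (auto simp: WM.W_nonneg)
  ultimately show ?thesis by (intro that[of "B + 1"]) (auto intro: order_trans)
qed

end

section \<open>Loops\<close>

lemma concat_blocks:
  assumes "length w = n * k"
  shows "\<exists>ws. length ws = n \<and> (\<forall>b\<in>set ws. length b = k) \<and> concat ws = w"
  using assms
proof (induction n arbitrary: w)
  case (Suc n)
  then obtain ws where "length ws = n" "\<forall>b\<in>set ws. length b = k" "concat ws = drop k w"
    by (metis add_diff_cancel_left' length_drop mult_Suc)
  with Suc.prems show ?case by (intro exI[of _ "take k w # ws"]) auto
qed auto

lemma length_concat_blocks:
  "\<forall>b\<in>set ws. length b = k \<Longrightarrow> length (concat ws) = length ws * k"
  by (induction ws) auto

context markov_potential
begin

text \<open>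
  The potential may have infinite variation on cylinders of length at most \<open>k\<close>, so loops at a
  letter need not have bounded distortion.  Blocks of length \<open>k\<close> are therefore taken as letters.
\<close>

definition "block_weight r ws =
  (if \<forall>b\<in>set ws. length b = k then WM (concat ws) * (1 / r) ^ length (concat ws) else 0)"

lemma submultiplicative_block_weight:
  assumes "0 < r"
  shows "submultiplicative_weight (block_weight r)"
proof -
  interpret V: submultiplicative_weight "\<lambda>w. WM w * (1 / r) ^ length w"
    by (rule scaled[OF assms])
  show ?thesis
  proof
    show "0 \<le> block_weight r w" for w using V.W_nonneg[of "concat w"] by (simp add: block_weight_def)
    show "block_weight r [] \<le> 1" using V.W_Nil by (simp add: block_weight_def)
    show "block_weight r (u @ v) \<le> block_weight r u * block_weight r v" for u v
      using V.W_append[of "concat u" "concat v"] by (auto simp: block_weight_def)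
  qed
qed

text \<open>Contrapositive of the loop criterion over the alphabet of blocks. Every word is a
  concatenation of blocks followed by a remainder shorter than \<open>k\<close>, so summability over
  blocks would force convergence at \<open>r\<close>. Blocks of another length have weight
  \<open>0\<close> and cannot cause divergence.\<close>

lemma exists_block_with_divergent_loops:
  assumes "0 < r" "r < growth_rate"
  obtains a where "length a = k"
    "\<not> block_weight r summable_on {l. l \<noteq> [] \<and> hd l = a \<and> last l = a}"
proof -
  let ?V = "\<lambda>w. WM w * (1 / r) ^ length w"
  let ?L = "\<lambda>a. {l. l \<noteq> [] \<and> hd l = a \<and> last l = a}"
  interpret V: submultiplicative_weight ?V by (rule scaled[OF assms(1)])
  interpret B: submultiplicative_weight "block_weight r"
    by (rule submultiplicative_block_weight[OF assms(1)])
  have letters: "(\<lambda>b. ?V [b]) summable_on UNIV"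
    using summable_on_cmult_left[OF summable_letters, of "1 / r"] by simp
  have "\<not> ?V summable_on UNIV"
    using assms cInf_lower[OF _ bdd_below_rates, of r] by (auto simp: rates_def growth_rate_def)
  moreover have "?V summable_on UNIV" if *: "block_weight r summable_on UNIV"
  proof -
    let ?K = "{ws. \<forall>b\<in>set ws. length b = k}"
    have "(\<lambda>ws. ?V (concat ws)) summable_on ?K \<longleftrightarrow> block_weight r summable_on ?K"
      by (rule summable_on_cong) (simp add: block_weight_def)
    with * have "?V summable_on concat ` ?K"
      by (intro summable_on_image) (auto intro: summable_on_subset)
    from V.summable_on_append[OF this V.summable_on_short[OF letters, of k]]
    show ?thesis
    proof (rule summable_on_subset, intro subsetI)
      fix w :: "'s list"
      let ?u = "take (length w div k * k) w" and ?v = "drop (length w div k * k) w"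
      have "length ?u = length w div k * k" by simp
      from concat_blocks[OF this] have "?u \<in> concat ` ?K" by force
      moreover have "length ?v < k"
        using k_pos mod_less_divisor[of k "length w"] by (simp add: minus_div_mult_eq_mod)
      moreover have "w = ?u @ ?v" by simp
      ultimately show "w \<in> {u @ v |u v. u \<in> concat ` ?K \<and> v \<in> {w. length w < k}}"
        by blast
    qed
  qed
  moreover have "(\<lambda>b. block_weight r [b]) summable_on UNIV"
  proof -
    have "(\<lambda>b. block_weight r [b]) summable_on UNIV \<longleftrightarrow> ?V summable_on {w. length w = k}"
      by (rule summable_on_cong_neutral) (auto simp: block_weight_def)
    with V.summable_on_fixed_length[OF letters] show ?thesis by blast
  qed
  ultimately obtain a where a: "\<not> block_weight r summable_on ?L a"
    using B.summable_on_words_if_loops by blast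
  moreover have "length a = k"
  proof (rule ccontr)
    assume "length a \<noteq> k"
    then have "block_weight r summable_on ?L a \<longleftrightarrow> (\<lambda>_. 0 :: real) summable_on ?L a"
      by (intro summable_on_cong) (auto simp: block_weight_def)
    with a show False by simp
  qed
  ultimately show ?thesis using that by blast
qed

text \<open>If all finite families of loops at \<open>a\<close> failed the bound, then at an
  intermediate rate \<open>s\<close> the loop series would be dominated by a geometric series of
  ratio \<open>(r / s) ^ k\<close>. The exponent counts \<open>q\<close> of the \<open>q + 1\<close>
  blocks, because the closing block will be shared with the next loop. \<open>K\<close> depends on
  \<open>a\<close>, which is found only after \<open>r\<close>.\<close>

lemma loops_of_fixed_length:
  assumes r: "0 < r" "r < growth_rate" and K: "\<And>a. 0 < K a"
  obtains a q L where "length a = k" "finite L"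
    "L \<subseteq> {l. l \<noteq> [] \<and> hd l = a \<and> last l = a \<and> length l = Suc q \<and> (\<forall>b\<in>set l. length b = k)}"
    "K a * r ^ (q * k) < (\<Sum>l\<in>L. WM (concat l))"
proof -
  obtain s where s: "r < s" "s < growth_rate" using r dense by blast
  then have "0 < s" using r by simp
  then obtain a where a: "length a = k"
    "\<not> block_weight s summable_on {l. l \<noteq> [] \<and> hd l = a \<and> last l = a}"
    using exists_block_with_divergent_loops[OF _ s(2)] by blast
  interpret B: submultiplicative_weight "block_weight s"
    by (rule submultiplicative_block_weight[OF \<open>0 < s\<close>])
  let ?T = "\<lambda>q. {l. l \<noteq> [] \<and> hd l = a \<and> last l = a \<and> length l = Suc q \<and> (\<forall>b\<in>set l. length b = k)}"
  have "\<exists>q L. finite L \<and> L \<subseteq> ?T q \<and> K a * r ^ (q * k) < (\<Sum>l\<in>L. WM (concat l))"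
  proof (rule ccontr)
    assume "\<not> ?thesis"
    then have bound: "(\<Sum>l\<in>L. WM (concat l)) \<le> K a * r ^ (q * k)" if "finite L" "L \<subseteq> ?T q" for L q
      using that by (meson not_le)
    define x where "x = (r / s) ^ k"
    have x: "0 \<le> x" "x < 1"
      using r s k_pos \<open>0 < s\<close> by (auto simp: x_def power_less_one_iff)
    define c where "c = K a * (1 / s) ^ k"
    have c: "0 \<le> c" using K[of a] \<open>0 < s\<close> by (simp add: c_def less_imp_le)
    have "block_weight s summable_on {l. l \<noteq> [] \<and> hd l = a \<and> last l = a}"
    proof (rule summable_on_boundedI[where B = "c * (\<Sum>q. x ^ q)"])
      fix F assume F: "finite F" "F \<subseteq> {l. l \<noteq> [] \<and> hd l = a \<and> last l = a}"
      define N where "N = Suc (Max (insert 0 (length ` F)))"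
      have N: "length l - 1 < N" if "l \<in> F" for l
      proof -
        have "length l \<le> Max (insert 0 (length ` F))" using that F(1) by (intro Max_ge) auto
        then show ?thesis by (simp add: N_def)
      qed
      have "sum (block_weight s) F = (\<Sum>q<N. \<Sum>l | l \<in> F \<and> length l - 1 = q. block_weight s l)"
        using N F by (subst sum.group) auto
      also have "\<dots> \<le> (\<Sum>q<N. c * x ^ q)"
      proof (intro sum_mono)
        fix q
        \<comment> \<open>Lists containing a block of the wrong length have weight \<open>0\<close>;
          all other loops in this group lie in \<open>?T q\<close>.\<close>
        have "(\<Sum>l | l \<in> F \<and> length l - 1 = q. block_weight s l) = (\<Sum>l\<in>F \<inter> ?T q. block_weight s l)"
          using F by (intro sum.mono_neutral_right) (auto simp: block_weight_def)
        also have "\<dots> = (\<Sum>l\<in>F \<inter> ?T q. WM (concat l) * (1 / s) ^ (Suc q * k))"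
          by (intro sum.cong) (auto simp: block_weight_def length_concat_blocks[of _ k])
        also have "\<dots> \<le> K a * r ^ (q * k) * (1 / s) ^ (Suc q * k)"
          unfolding sum_distrib_right[symmetric] using F \<open>0 < s\<close>
          by (intro mult_right_mono bound) auto
        also have "\<dots> = c * x ^ q"
        proof -
          have "x ^ q = r ^ (q * k) * (1 / s) ^ (q * k)"
            by (simp add: x_def power_mult[symmetric] power_divide mult.commute)
          then show ?thesis by (simp add: c_def power_add)
        qed
        finally show "(\<Sum>l | l \<in> F \<and> length l - 1 = q. block_weight s l) \<le> c * x ^ q" .
      qed
      also have "\<dots> = c * (\<Sum>q<N. x ^ q)" by (simp add: sum_distrib_left)
      also have "\<dots> \<le> c * (\<Sum>q. x ^ q)"
        using x c by (intro mult_left_mono sum_le_suminf summable_geometric) auto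
      finally show "sum (block_weight s) F \<le> c * (\<Sum>q. x ^ q)" .
    qed (rule B.W_nonneg)
    with a show False by blast
  qed
  with a(1) that show ?thesis by blast
qed

text \<open>The words in \<open>L\<close> are loops with the closing copy of \<open>a\<close>
  removed: each begins with \<open>a\<close> and may be followed by \<open>a\<close>. The number
  \<open>p w\<close> bounds the exponential Birkhoff sum from below uniformly on the cylinder of
  \<open>w @ a\<close>, so such bounds multiply under concatenation.\<close>

definition loop_system :: "'s list \<Rightarrow> nat \<Rightarrow> 's list set \<Rightarrow> ('s list \<Rightarrow> real) \<Rightarrow> bool" where
  "loop_system a N L p \<longleftrightarrow> length a = k \<and> k \<le> N \<and> finite L \<and> L \<noteq> {} \<and>
     (\<forall>w\<in>L. length w = N \<and> take k w = a \<and> admissible (w @ a) \<and> 0 < p w \<and>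
        (\<forall>\<omega>\<in>cyl (w @ a). p w \<le> exp (birkhoff_sum N \<phi> \<omega>)))"

text \<open>The factor \<open>K a\<close> pays once for the distortion and for the closing block.
  Dividing weights by it turns them into genuine lower bounds for Birkhoff sums.\<close>

lemma exists_loop_system:
  assumes r: "0 < r" "r < growth_rate"
  obtains a N L p where "loop_system a N L p" "r ^ N \<le> sum p L"
proof -
  define K where "K = (\<lambda>a. exp max_distortion * wt a)"
  have Kpos: "0 < K a" for a by (simp add: K_def)
  obtain a q L where aqL: "length a = k" "finite L"
    "L \<subseteq> {l. l \<noteq> [] \<and> hd l = a \<and> last l = a \<and> length l = Suc q \<and> (\<forall>b\<in>set l. length b = k)}"
    "K a * r ^ (q * k) < (\<Sum>l\<in>L. WM (concat l))"
    by (rule loops_of_fixed_length[OF r Kpos])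
  \<comment> \<open>For \<open>q = 0\<close> the only loop is the single block \<open>a\<close>,
    whose weight does not exceed \<open>K a\<close>. Excluding this case gives loop length at least
    \<open>k\<close>.\<close>
  have "q \<noteq> 0"
  proof
    assume "q = 0"
    have "L \<subseteq> {[a]}"
    proof
      fix l assume "l \<in> L"
      then have "l \<noteq> []" "last l = a" "length l = Suc 0" using aqL(3) \<open>q = 0\<close> by auto
      then show "l \<in> {[a]}" by (cases l) auto
    qed
    then have "(\<Sum>l\<in>L. WM (concat l)) \<le> (\<Sum>l\<in>{[a]}. WM (concat l))"
      by (intro sum_mono2) (auto simp: WM.W_nonneg)
    also have "\<dots> \<le> wt a" by (simp add: WM_def less_imp_le)
    also have "\<dots> \<le> K a" using max_distortion_nonneg by (simp add: K_def)
    finally show False using aqL(4) \<open>q = 0\<close> by simp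
  qed
  \<comment> \<open>Discarding loops of weight zero keeps the sum and makes every remaining word
    admissible with positive \<open>p\<close>.\<close>
  define L' where "L' = {l\<in>L. 0 < WM (concat l)}"
  define g where "g = (\<lambda>l :: 's list list. concat (butlast l))"
  have L': "l \<noteq> []" "hd l = a" "last l = a" "length l = Suc q" "\<forall>b\<in>set l. length b = k"
     "0 < WM (concat l)" if "l \<in> L'" for l using that aqL(3) by (auto simp: L'_def)
  have concat_eq: "concat l = g l @ a" if "l \<in> L'" for l
    using L'(1,3)[OF that] append_butlast_last_id[of l] by (metis concat.simps concat_append append_Nil2 g_def)
  have len: "length (g l) = q * k" if "l \<in> L'" for l
    using L'[OF that] by (subst g_def, subst length_concat_blocks[of _ k]) (auto dest: in_set_butlastD)
  have inj: "inj_on g L'"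
  proof (rule inj_onI)
    fix l m assume lm: "l \<in> L'" "m \<in> L'" "g l = g m"
    then have "concat l = concat m" by (simp add: concat_eq)
    moreover have "length x = length y" if "(x, y) \<in> set (zip l m)" for x y
      using that L'(5) lm(1,2) set_zip_leftD set_zip_rightD by metis
    ultimately show "l = m"
      using L'(4) lm(1,2) by (intro concat_injective) auto
  qed
  have sum_L': "(\<Sum>l\<in>L. WM (concat l)) = (\<Sum>l\<in>L'. WM (concat l))"
    using aqL(2) WM.W_nonneg by (intro sum.mono_neutral_right) (auto simp: L'_def less_le)
  moreover have "0 < K a * r ^ (q * k)" using Kpos r by simp
  ultimately have "L' \<noteq> {}" using aqL(4) by auto
  define p where "p = (\<lambda>w. WM (w @ a) / K a)"
  have sys: "loop_system a (q * k) (g ` L') p"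
    unfolding loop_system_def
  proof (intro conjI ballI)
    show "length a = k" by (rule aqL)
    show "k \<le> q * k" using \<open>q \<noteq> 0\<close> by simp
    show "finite (g ` L')" using aqL(2) by (simp add: L'_def)
    show "g ` L' \<noteq> {}" using \<open>L' \<noteq> {}\<close> by simp
    fix w assume "w \<in> g ` L'"
    then obtain l where l: "l \<in> L'" "w = g l" by blast
    have pos: "0 < WM (w @ a)" using L'(6)[OF l(1)] concat_eq[OF l(1)] l(2) by simp
    show "length w = q * k" using len l by simp
    show "take k w = a"
      using L'(1,2,4)[OF l(1)] \<open>q \<noteq> 0\<close> aqL(1) unfolding l(2) g_def
      by (cases l) auto
    show "admissible (w @ a)" using pos by (auto simp: WM_def split: if_splits)
    show "0 < p w" using pos Kpos[of a] by (simp add: p_def)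
    fix \<omega> assume \<omega>: "\<omega> \<in> cyl (w @ a)"
    have "WM (w @ a) \<le> exp (birkhoff_sum (length w) \<phi> \<omega> + distortion (length w)) * wt a"
      using pos wt_le_exp_birkhoff[OF \<omega>] aqL(1) by (auto simp: WM_def split: if_splits)
    also have "\<dots> \<le> exp (birkhoff_sum (length w) \<phi> \<omega> + max_distortion) * wt a"
      using distortion_le by (intro mult_right_mono) (auto intro: less_imp_le)
    also have "\<dots> = exp (birkhoff_sum (q * k) \<phi> \<omega>) * K a"
      using len[OF l(1)] l(2) by (simp add: exp_add K_def)
    finally show "p w \<le> exp (birkhoff_sum (q * k) \<phi> \<omega>)"
      using Kpos[of a] by (simp add: p_def field_simps)
  qed
  have "(\<Sum>l\<in>L. WM (concat l)) = (\<Sum>l\<in>L'. K a * p (g l))"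
    unfolding sum_L' using Kpos[of a] by (intro sum.cong) (auto simp: p_def concat_eq)
  also have "\<dots> = K a * sum p (g ` L')"
    using inj by (simp add: sum.reindex sum_distrib_left)
  finally have "r ^ (q * k) \<le> sum p (g ` L')"
    using aqL(4) Kpos[of a] by simp
  with sys show ?thesis by (rule that)
qed

text \<open>Whatever follows a loop in \<open>concat \<tau> @ a\<close> begins with
  \<open>a\<close>. Hence admissibility glues across each seam, and each shifted point lies in the
  cylinder where the bound \<open>p\<close> applies, with no loss per concatenation.\<close>

lemma
  assumes sys: "loop_system a N L p" and "set \<tau> \<subseteq> L"
  shows length_loop_concat: "length (concat \<tau>) = length \<tau> * N"
    and loop_concat_prefix: "take k (concat \<tau> @ a) = a"
    and admissible_loop_concat: "admissible (concat \<tau> @ a)"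
    and prod_le_exp_birkhoff: "\<omega> \<in> cyl (concat \<tau> @ a) \<Longrightarrow>
      prod_list (map p \<tau>) \<le> exp (birkhoff_sum (length \<tau> * N) \<phi> \<omega>)"
proof -
  have L: "length w = N" "take k w = a" "admissible (w @ a)" "0 < p w"
    "\<And>\<omega>. \<omega> \<in> cyl (w @ a) \<Longrightarrow> p w \<le> exp (birkhoff_sum N \<phi> \<omega>)" if "w \<in> L" for w
    using sys that by (auto simp: loop_system_def)
  have a: "length a = k" "k \<le> N" "a \<noteq> []" using sys k_pos by (auto simp: loop_system_def)
  show len: "length (concat \<tau>) = length \<tau> * N"
    using assms(2) L(1) by (intro length_concat_blocks) auto
  have prefix: "take k (concat \<tau> @ a) = a" if "set \<tau> \<subseteq> L" for \<tau>
    using that a L by (cases \<tau>) auto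
  then show "take k (concat \<tau> @ a) = a" using assms(2) .
  have split: "\<exists>z. concat \<tau> @ a = a @ z" if "set \<tau> \<subseteq> L" for \<tau>
    using prefix[OF that] append_take_drop_id[of k "concat \<tau> @ a"] by metis
  show "admissible (concat \<tau> @ a)"
    using assms(2)
  proof (induction \<tau>)
    case Nil
    obtain w where "w \<in> L" using sys by (auto simp: loop_system_def)
    from L(3)[OF this] show ?case by (simp add: successively_append_iff)
  next
    case (Cons w \<tau>)
    obtain z where z: "concat \<tau> @ a = a @ z" using split Cons.prems by auto
    have "admissible (w @ a)" using L Cons.prems by simp
    moreover have "admissible (a @ z)" using Cons z by simp
    ultimately have "admissible (w @ a @ z)"
      using a(3) by (auto simp: successively_append_iff)
    then show ?case using z by simp
  qed
  show "prod_list (map p \<tau>) \<le> exp (birkhoff_sum (length \<tau> * N) \<phi> \<omega>)"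
    if "\<omega> \<in> cyl (concat \<tau> @ a)"
    using assms(2) that
  proof (induction \<tau> arbitrary: \<omega>)
    case Nil
    then show ?case by (simp add: birkhoff_sum_def)
  next
    case (Cons w \<tau>)
    obtain z where z: "concat \<tau> @ a = a @ z" using split Cons.prems by auto
    have w: "w \<in> L" "set \<tau> \<subseteq> L" using Cons.prems by auto
    have "\<omega> \<in> cyl ((w @ a) @ z)" using Cons.prems z by simp
    then have "\<omega> \<in> cyl (w @ a)" using cylinder_append_subset by blast
    then have 1: "p w \<le> exp (birkhoff_sum N \<phi> \<omega>)" by (rule L(5)[OF w(1)])
    have "(left_shift ^^ N) \<omega> \<in> cyl (concat \<tau> @ a)"
      using Cons.prems(2) cyl_append[of \<omega> w "concat \<tau> @ a"] L(1)[OF w(1)] by simp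
    then have 2: "prod_list (map p \<tau>) \<le> exp (birkhoff_sum (length \<tau> * N) \<phi> ((left_shift ^^ N) \<omega>))"
      by (rule Cons.IH[OF w(2)])
    have "prod_list (map p (w # \<tau>)) \<le> exp (birkhoff_sum N \<phi> \<omega>) *
        exp (birkhoff_sum (length \<tau> * N) \<phi> ((left_shift ^^ N) \<omega>))"
      using 1 2 L(4) w by (auto intro!: mult_mono prod_list_nonneg less_imp_le[OF L(4)])
    also have "\<dots> = exp (birkhoff_sum (length (w # \<tau>) * N) \<phi> \<omega>)"
      by (simp add: birkhoff_sum_add exp_add)
    finally show ?case .
  qed
qed

text \<open>Repeating \<open>u\<close> periodically reads \<open>u @ a\<close> at the start because
  \<open>u\<close> begins with \<open>a\<close>. This is how admissible words are realised by points
  of \<open>Y\<close>.\<close>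

lemma periodic_point_in_cylinder:
  assumes "admissible (u @ a)" "take k u = a" "length a = k" "k \<le> length u"
  obtains x where "x \<in> Y" "x \<in> cyl (u @ a)"
proof -
  define n where "n = length u"
  define x where "x = (\<lambda>i. u ! (i mod n))"
  have n: "0 < n" "k \<le> n" using assms k_pos by (auto simp: n_def)
  have ua: "(u @ a) ! i = x i" if "i < n + k" for i
  proof (cases "i < n")
    case False
    then have "i mod n = i - n" using that n by (simp add: mod_if)
    moreover have "a ! (i - n) = u ! (i - n)"
      using that False assms(2) n by (metis add_less_cancel_left le_add_diff_inverse not_less nth_take)
    ultimately show ?thesis using False by (simp add: x_def nth_append n_def)
  qed (simp add: x_def nth_append n_def)
  have M: "M (x i) (x (Suc i)) = 1" for i
  proof -
    \<comment> \<open>At the seam \<open>Suc (i mod n)\<close> equals \<open>n\<close>, a position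
      inside the closing copy of \<open>a\<close>, which is nonempty.\<close>
    have *: "Suc (i mod n) < n + k" using n k_pos mod_less_divisor[of n i] by linarith
    then have "M ((u @ a) ! (i mod n)) ((u @ a) ! Suc (i mod n)) = 1"
      using assms(1,3) by (auto simp: successively_conv_nth n_def)
    then have "M (x (i mod n)) (x (Suc (i mod n))) = 1" using ua * by simp
    then show ?thesis by (simp add: x_def mod_Suc_eq)
  qed
  have "x \<in> Y" using M M_imp_S0 by (auto simp: Y_def markov_shift_def)
  moreover have "x \<in> cyl (u @ a)"
    using \<open>x \<in> Y\<close> Y_subset_X ua assms(3) by (auto simp: cylinder_def n_def)
  ultimately show ?thesis by (rule that)
qed

lemma concat_loops_inj:
  assumes "loop_system a N L p"
  shows "inj_on concat {\<tau>. set \<tau> \<subseteq> L \<and> length \<tau> = j}"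
proof (rule inj_onI)
  fix \<tau> \<tau>' assume *: "\<tau> \<in> {\<tau>. set \<tau> \<subseteq> L \<and> length \<tau> = j}" "\<tau>' \<in> {\<tau>. set \<tau> \<subseteq> L \<and> length \<tau> = j}"
    "concat \<tau> = concat \<tau>'"
  have "length x = length y" if "(x, y) \<in> set (zip \<tau> \<tau>')" for x y
  proof -
    have "x \<in> L" "y \<in> L" using set_zip_leftD[OF that] set_zip_rightD[OF that] * by auto
    then show ?thesis using assms by (auto simp: loop_system_def)
  qed
  then show "\<tau> = \<tau>'" using * by (intro concat_injective) auto
qed

section \<open>The pressure of the subsystem\<close>

definition "Y_term n w = exp (SUP \<omega>\<in>cylinder Y w. birkhoff_sum n \<phi> \<omega>)"
definition "Y_words n = {w. length w = n \<and> cylinder Y w \<noteq> {}}"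

lemma
  assumes "w \<in> Y_words n"
  shows Y_term_upper: "Y_term n w \<le> WM w"
    and Y_term_lower: "\<omega> \<in> cylinder Y w \<Longrightarrow> exp (birkhoff_sum n \<phi> \<omega>) \<le> Y_term n w"
proof -
  have w: "length w = n" "cylinder Y w \<noteq> {}" using assms by (auto simp: Y_words_def)
  have sub: "cylinder Y w \<subseteq> cyl w" using Y_subset_X by (auto simp: cylinder_def)
  have le: "birkhoff_sum n \<phi> \<omega> \<le> ln (wt w)" if "\<omega> \<in> cylinder Y w" for \<omega>
    using exp_birkhoff_le_wt[of \<omega> w] that sub w(1) by (subst ln_ge_iff) auto
  obtain \<upsilon> where \<upsilon>: "\<upsilon> \<in> cylinder Y w" using w(2) by blast
  then have "w = map \<upsilon> [0..<n]" using w(1) by (auto simp: cylinder_def intro: nth_equalityI)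
  then have "admissible w"
    using \<upsilon> successively_prefix[of \<upsilon> S\<^sub>0 M n] by (auto simp: cylinder_def Y_def)
  then have "WM w = wt w" using sub w by (auto simp: WM_def)
  moreover have "(SUP \<omega>\<in>cylinder Y w. birkhoff_sum n \<phi> \<omega>) \<le> ln (wt w)"
    by (intro cSUP_least w(2) le)
  then have "Y_term n w \<le> exp (ln (wt w))" unfolding Y_term_def by (simp only: exp_le_cancel_iff)
  ultimately show "Y_term n w \<le> WM w" by simp
  show "exp (birkhoff_sum n \<phi> \<omega>) \<le> Y_term n w" if "\<omega> \<in> cylinder Y w"
    unfolding Y_term_def using that le by (auto intro!: cSUP_upper bdd_aboveI2)
qed

lemma Y_term_nonneg [simp]: "0 \<le> Y_term n w"
  by (simp add: Y_term_def)

lemma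
  assumes "growth_rate < r"
  shows Y_term_summable: "Y_term n summable_on Y_words n"
    and Y_sum_upper: "\<exists>C>0. \<forall>n. infsum (Y_term n) (Y_words n) \<le> C * r ^ n"
proof -
  obtain C where C: "0 < C" "\<And>n F. finite F \<Longrightarrow> F \<subseteq> {w. length w = n} \<Longrightarrow> sum WM F \<le> C * r ^ n"
    by (rule sum_WM_upper[OF assms]) blast
  have le: "sum (Y_term n) F \<le> C * r ^ n" if "finite F" "F \<subseteq> Y_words n" for F n
  proof -
    have "sum (Y_term n) F \<le> sum WM F" using that by (intro sum_mono Y_term_upper) auto
    also have "\<dots> \<le> C * r ^ n" using that by (intro C) (auto simp: Y_words_def)
    finally show ?thesis .
  qed
  then have sm: "Y_term n summable_on Y_words n" for n by (intro summable_on_boundedI) auto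
  then show "Y_term n summable_on Y_words n" .
  show "\<exists>C>0. \<forall>n. infsum (Y_term n) (Y_words n) \<le> C * r ^ n"
    using C(1) le sm by (auto intro!: infsum_le_finite_sums)
qed

text \<open>Lists of \<open>n div N\<close> loops yield distinct words of length \<open>n\<close>,
  and summing the products of \<open>p\<close> over them gives a power of \<open>sum p L\<close>.
  One further fixed loop \<open>w0\<close> extends each word beyond time \<open>n\<close>.\<close>

lemma Y_sum_lower:
  assumes r: "0 < r" "r < growth_rate"
  shows "\<exists>c>0. \<forall>n. c * r ^ n \<le> infsum (Y_term n) (Y_words n)"
proof -
  obtain a N L p where sys: "loop_system a N L p" and sum_p: "r ^ N \<le> sum p L"
    by (rule exists_loop_system[OF r])
  obtain c where c: "0 \<le> c" "\<And>\<omega>. \<omega> \<in> X \<Longrightarrow> \<phi> \<omega> \<le> c" by (rule phi_bounded_above) blast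
  have N: "0 < N" and a: "length a = k" "k \<le> N" and fin: "finite L"
    using sys k_pos by (auto simp: loop_system_def)
  have p_pos: "0 < p w" "length w = N" if "w \<in> L" for w using sys that by (auto simp: loop_system_def)
  have "0 < r ^ N" using r by simp
  with sum_p have "L \<noteq> {}" by auto
  then obtain w0 where w0: "w0 \<in> L" by blast
  \<comment> \<open>The padding loop contributes \<open>p w0\<close>, and cutting off at most
    \<open>N\<close> surplus terms of the Birkhoff sum costs at most the factor
    \<open>exp (real N * c)\<close>.\<close>
  define d where "d = exp (- (real N * c)) * p w0"
  have d: "0 < d" using p_pos w0 by (simp add: d_def)
  have "d / max 1 r ^ N * r ^ n \<le> infsum (Y_term n) (Y_words n)" for n
  proof -
    define j where "j = n div N"
    have jn: "j * N \<le> n" "n \<le> Suc j * N"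
      using div_mult_mod_eq[of n N] mod_less_divisor[OF N, of n] unfolding j_def mult_Suc by linarith+
    define T where "T = {\<tau>. set \<tau> \<subseteq> L \<and> length \<tau> = j}"
    have finT: "finite T" unfolding T_def using fin by (rule finite_lists_length_eq)
    have "\<exists>x. x \<in> Y \<and> x \<in> cyl (concat (\<tau> @ [w0]) @ a)" if "\<tau> \<in> T" for \<tau>
    proof -
      have L: "set (\<tau> @ [w0]) \<subseteq> L" using that w0 by (auto simp: T_def)
      have len: "k \<le> length (concat (\<tau> @ [w0]))" using a p_pos(2)[OF w0] by simp
      obtain x where "x \<in> Y" "x \<in> cyl (concat (\<tau> @ [w0]) @ a)"
        using periodic_point_in_cylinder[OF admissible_loop_concat[OF sys L] _ a(1) len]
          loop_concat_prefix[OF sys L] len by auto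
      then show ?thesis by blast
    qed
    then obtain x where x: "\<And>\<tau>. \<tau> \<in> T \<Longrightarrow> x \<tau> \<in> Y" "\<And>\<tau>. \<tau> \<in> T \<Longrightarrow> x \<tau> \<in> cyl (concat (\<tau> @ [w0]) @ a)"
      by metis
    define f where "f = (\<lambda>\<tau>. map (x \<tau>) [0..<n])"
    have take_f: "take (j * N) (f \<tau>) = concat \<tau>" if "\<tau> \<in> T" for \<tau>
    proof -
      have len: "length (concat \<tau>) = j * N"
        using that length_loop_concat[OF sys, of \<tau>] by (simp add: T_def)
      have "x \<tau> \<in> cyl (concat \<tau>)"
        using x(2)[OF that] cylinder_append_subset[of X "concat \<tau>" "w0 @ a"] by auto
      then show ?thesis using len jn
        by (intro nth_equalityI) (auto simp: f_def cylinder_def)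
    qed
    \<comment> \<open>The first \<open>j * N\<close> letters of \<open>f \<tau>\<close> spell
      \<open>concat \<tau>\<close>, which determines \<open>\<tau>\<close> because all loops have
      equal length.\<close>
    have inj: "inj_on f T"
      using take_f concat_loops_inj[OF sys, of j] unfolding T_def[symmetric] inj_on_def by metis
    have fY: "f \<tau> \<in> Y_words n" "x \<tau> \<in> cylinder Y (f \<tau>)" if "\<tau> \<in> T" for \<tau>
      using mem_cylinder_prefix[OF x(1)[OF that], of n] by (auto simp: Y_words_def f_def)
    have bound: "d * prod_list (map p \<tau>) \<le> Y_term n (f \<tau>)" if "\<tau> \<in> T" for \<tau>
    proof -
      have L: "set (\<tau> @ [w0]) \<subseteq> L" "length \<tau> = j" using that w0 by (auto simp: T_def)
      have X: "x \<tau> \<in> X" using x(2)[OF that] by (rule cyl_in_X)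
      define i where "i = Suc j * N - n"
      have i: "Suc j * N = n + i" "i \<le> N" using jn by (auto simp: i_def)
      have "prod_list (map p \<tau>) * p w0 \<le> exp (birkhoff_sum (Suc j * N) \<phi> (x \<tau>))"
        using prod_le_exp_birkhoff[OF sys L(1) x(2)[OF that]] L(2) by simp
      also have "\<dots> \<le> exp (birkhoff_sum n \<phi> (x \<tau>) + real N * c)"
      proof -
        have "birkhoff_sum i \<phi> ((left_shift ^^ n) (x \<tau>)) \<le> real i * c"
          by (intro birkhoff_sum_le c(2) shift_X X)
        also have "\<dots> \<le> real N * c" using i c by (intro mult_right_mono) auto
        finally show ?thesis unfolding i(1) by (simp add: birkhoff_sum_add)
      qed
      also have "\<dots> \<le> Y_term n (f \<tau>) * exp (real N * c)"
        using Y_term_lower[OF fY[OF that]] by (simp add: exp_add)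
      finally show ?thesis by (simp add: d_def exp_minus field_simps)
    qed
    have "d / max 1 r ^ N * r ^ n \<le> d * r ^ (j * N)"
    proof -
      have "r ^ n \<le> max 1 r ^ N * r ^ (j * N)"
        using r N jn by (intro power_le_max_power_mult) (auto simp: j_def)
      then show ?thesis using d r by (simp add: field_simps)
    qed
    also have "\<dots> \<le> d * sum p L ^ j"
      using d sum_p r by (intro mult_left_mono) (auto simp: power_mult mult.commute[of j] intro!: power_mono)
    also have "\<dots> = (\<Sum>\<tau>\<in>T. d * prod_list (map p \<tau>))"
      unfolding T_def by (subst sum_prod_list_lists[OF fin, symmetric]) (simp add: sum_distrib_left)
    also have "\<dots> \<le> (\<Sum>\<tau>\<in>T. Y_term n (f \<tau>))" by (intro sum_mono bound)
    also have "\<dots> = sum (Y_term n) (f ` T)" using inj by (simp add: sum.reindex)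
    also have "\<dots> \<le> infsum (Y_term n) (Y_words n)"
      using finT fY Y_term_summable[of "growth_rate + 1"] by (intro sum_le_infsum_subset) auto
    finally show ?thesis .
  qed
  moreover have "0 < d / max 1 r ^ N" using d by simp
  ultimately show ?thesis by blast
qed

text \<open>The two-sided bounds prove that the limit exists, so \<open>lim\<close> in the
  definition of pressure has its intended value.\<close>

lemma pressure_Y: "pressure Y \<phi> = ln growth_rate"
proof -
  have "(\<lambda>n. 1 / real n * ln (infsum (Y_term n) (Y_words n))) \<longlonglongrightarrow> ln growth_rate"
    by (rule growth_rate_tendsto[OF growth_rate_pos Y_sum_upper Y_sum_lower])
  then show ?thesis
    unfolding pressure_def Y_term_def Y_words_def by (rule limI)
qed

end

section \<open>The metric and the eigenmeasure\<close>

text \<open>Balls of radius \<open>\<theta> ^ n\<close> are cylinders of length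
  \<open>n + 1\<close>; the strict inequality accounts for the extra coordinate.\<close>

lemma dist_theta_less_iff:
  assumes "0 < \<theta>" "\<theta> < 1"
  shows "dist_theta \<theta> \<omega> \<upsilon> < \<theta> ^ n \<longleftrightarrow> (\<forall>i\<le>n. \<omega> i = \<upsilon> i)"
proof (cases "\<omega> = \<upsilon>")
  case True
  then show ?thesis using assms by (simp add: dist_theta_def)
next
  case False
  define m where "m = (LEAST n. \<omega> n \<noteq> \<upsilon> n)"
  have m: "\<omega> m \<noteq> \<upsilon> m" using LeastI_ex[of "\<lambda>n. \<omega> n \<noteq> \<upsilon> n"] False by (auto simp: m_def fun_eq_iff)
  have "\<theta> ^ m < \<theta> ^ n \<longleftrightarrow> n < m" using assms by simp
  also have "\<dots> \<longleftrightarrow> (\<forall>i\<le>n. \<omega> i = \<upsilon> i)"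
    using m not_less_Least[of _ "\<lambda>n. \<omega> n \<noteq> \<upsilon> n", folded m_def] not_le order_le_less_trans by metis
  finally show ?thesis using False by (simp add: dist_theta_def m_def)
qed

lemma Metric_space_dist_theta:
  assumes "0 < \<theta>" "\<theta> < 1"
  shows "Metric_space X (dist_theta \<theta>)"
proof
  show "0 \<le> dist_theta \<theta> x y" for x y :: "nat \<Rightarrow> 's" using assms by (simp add: dist_theta_def)
  show "dist_theta \<theta> x y = dist_theta \<theta> y x" for x y :: "nat \<Rightarrow> 's"
    by (auto simp: dist_theta_def eq_commute)
  show "dist_theta \<theta> x y = 0 \<longleftrightarrow> x = y" for x y :: "nat \<Rightarrow> 's" using assms by (simp add: dist_theta_def)
  show "dist_theta \<theta> x z \<le> dist_theta \<theta> x y + dist_theta \<theta> y z" for x y z :: "nat \<Rightarrow> 's"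
  proof (cases "x = z")
    case True
    then show ?thesis using assms by (simp add: dist_theta_def)
  next
    case False
    define n where "n = (LEAST n. x n \<noteq> z n)"
    have "x n \<noteq> z n" using LeastI_ex[of "\<lambda>n. x n \<noteq> z n"] False by (auto simp: n_def fun_eq_iff)
    \<comment> \<open>At the first place where \<open>x\<close> and \<open>z\<close> differ,
      \<open>y\<close> differs from one of them, which gives even the ultrametric
      inequality.\<close>
    then have "\<not> (\<forall>i\<le>n. x i = y i) \<or> \<not> (\<forall>i\<le>n. y i = z i)" by auto
    then have "\<theta> ^ n \<le> dist_theta \<theta> x y \<or> \<theta> ^ n \<le> dist_theta \<theta> y z"
      by (simp add: dist_theta_less_iff[OF assms, symmetric] not_less)
    moreover have "dist_theta \<theta> x z = \<theta> ^ n" using False by (simp add: dist_theta_def n_def)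
    moreover have "0 \<le> dist_theta \<theta> x y" "0 \<le> dist_theta \<theta> y z" using assms by (simp_all add: dist_theta_def)
    ultimately show ?thesis by linarith
  qed
qed

lemma topspace_top_theta:
  assumes "0 < \<theta>" "\<theta> < 1"
  shows "topspace (top_theta \<theta> X) = X"
  using Metric_space.topspace_mtopology[OF Metric_space_dist_theta[OF assms]]
  by (simp add: top_theta_def)

lemma openin_top_thetaI:
  assumes "0 < \<theta>" "\<theta> < 1" "U \<subseteq> X"
    and "\<And>\<omega>. \<omega> \<in> U \<Longrightarrow> \<exists>n. \<forall>\<upsilon>\<in>X. (\<forall>i<n. \<omega> i = \<upsilon> i) \<longrightarrow> \<upsilon> \<in> U"
  shows "openin (top_theta \<theta> X) U"
proof -
  interpret Metric_space X "dist_theta \<theta>" by (rule Metric_space_dist_theta[OF assms(1,2)])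
  show ?thesis unfolding top_theta_def openin_mtopology
  proof (intro conjI allI impI)
    fix \<omega> assume "\<omega> \<in> U"
    then obtain n where n: "\<forall>\<upsilon>\<in>X. (\<forall>i<n. \<omega> i = \<upsilon> i) \<longrightarrow> \<upsilon> \<in> U" using assms(4) by blast
    have "mball \<omega> (\<theta> ^ n) \<subseteq> U"
      using n by (auto simp: dist_theta_less_iff[OF assms(1,2)])
    moreover have "0 < \<theta> ^ n" using assms by simp
    ultimately show "\<exists>r>0. mball \<omega> r \<subseteq> U" by blast
  qed (rule assms(3))
qed

lemma sets_borel_theta:
  assumes "0 < \<theta>" "\<theta> < 1"
  shows "space (borel_theta \<theta> X) = X"
    and "openin (top_theta \<theta> X) U \<Longrightarrow> U \<in> sets (borel_theta \<theta> X)"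
proof -
  have "{U. openin (top_theta \<theta> X) U} \<subseteq> Pow X"
    using openin_subset topspace_top_theta[OF assms] by blast
  then show "space (borel_theta \<theta> X) = X"
    and "openin (top_theta \<theta> X) U \<Longrightarrow> U \<in> sets (borel_theta \<theta> X)"
    by (auto simp: borel_theta_def space_measure_of_conv)
qed

lemma left_shift_prepend [simp]: "left_shift (prepend a \<omega>) = \<omega>"
  by (simp add: left_shift_def prepend_def)

lemma prepend_0 [simp]: "prepend a \<omega> 0 = a"
  by (simp add: prepend_def)

lemma prepend_left_shift: "prepend (\<omega> 0) (left_shift \<omega>) = \<omega>"
  by (auto simp: prepend_def left_shift_def fun_eq_iff split: nat.splits)

lemma prepend_in_markov_shift:
  "\<omega> \<in> markov_shift UNIV A \<Longrightarrow> prepend a \<omega> \<in> markov_shift UNIV A \<longleftrightarrow> A a (\<omega> 0) = 1"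
  by (auto simp: markov_shift_def prepend_def split: nat.splits)

section \<open>The eigenmeasure of cylinders\<close>

locale ruelle_potential = markov_potential A M S\<^sub>0 \<theta> \<phi> k
  for A M :: "'s::countable \<Rightarrow> 's \<Rightarrow> nat" and S\<^sub>0 \<theta> \<phi> k +
  fixes lam :: real and h :: "(nat \<Rightarrow> 's) \<Rightarrow> real" and \<nu> :: "(nat \<Rightarrow> 's) measure"
  assumes triplet: "ruelle_triplet \<theta> A \<phi> k lam h \<nu>"
begin

lemma lam_eq: "lam = exp (pressure X \<phi>)"
  and h_in_Fb: "(\<lambda>\<omega>. complex_of_real (h \<omega>)) \<in> Fb \<theta> X k"
  and h_nonneg: "\<omega> \<in> X \<Longrightarrow> 0 \<le> h \<omega>"
  and h_eigen: "\<omega> \<in> X \<Longrightarrow> transfer_op A \<phi> (\<lambda>\<omega>. complex_of_real (h \<omega>)) \<omega> = complex_of_real (lam * h \<omega>)"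
  and prob: "prob_space \<nu>"
  and sets_nu: "sets \<nu> = sets (borel_theta \<theta> X)"
  and nu_eigen: "f \<in> Cb \<theta> X \<Longrightarrow> (\<integral>\<omega>. transfer_op A \<phi> f \<omega> \<partial>\<nu>) = complex_of_real lam * (\<integral>\<omega>. f \<omega> \<partial>\<nu>)"
  and integral_h: "(\<integral>\<omega>. h \<omega> \<partial>\<nu>) = 1"
  using triplet by (auto simp: ruelle_triplet_def Let_def X_def)

sublocale prob_space \<nu>
  by (rule prob)

lemma lam_pos [simp]: "0 < lam"
  by (simp add: lam_eq)

lemma space_nu: "space \<nu> = X"
  using sets_eq_imp_space_eq[OF sets_nu] sets_borel_theta(1)[OF theta] by simp

lemma open_in_sets:
  assumes "U \<subseteq> X" "\<And>\<omega>. \<omega> \<in> U \<Longrightarrow> \<exists>n. \<forall>\<upsilon>\<in>X. (\<forall>i<n. \<omega> i = \<upsilon> i) \<longrightarrow> \<upsilon> \<in> U"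
  shows "U \<in> sets \<nu>"
  unfolding sets_nu
  by (intro sets_borel_theta(2)[OF theta] openin_top_thetaI[OF theta] assms)

lemma cyl_sets [measurable, simp]: "cyl w \<in> sets \<nu>"
proof (rule open_in_sets)
  fix \<omega> assume "\<omega> \<in> cyl w"
  then show "\<exists>n. \<forall>\<upsilon>\<in>X. (\<forall>i<n. \<omega> i = \<upsilon> i) \<longrightarrow> \<upsilon> \<in> cyl w"
    by (intro exI[of _ "length w"]) (auto simp: cylinder_def)
qed (auto simp: cylinder_def)

lemma integrable_indicator_cyl [simp]: "integrable \<nu> (indicat_real (cyl w))"
  by (intro integrable_real_indicator) (auto simp: less_top[symmetric])

lemma measurable_if_continuous:
  fixes f :: "(nat \<Rightarrow> 's) \<Rightarrow> real"
  assumes "\<And>\<omega> e. \<omega> \<in> X \<Longrightarrow> 0 < e \<Longrightarrow> \<exists>n. \<forall>\<upsilon>\<in>X. (\<forall>i<n. \<omega> i = \<upsilon> i) \<longrightarrow> \<bar>f \<upsilon> - f \<omega>\<bar> < e"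
  shows "f \<in> borel_measurable \<nu>"
proof (rule borel_measurableI)
  fix S :: "real set" assume S: "open S"
  show "f -` S \<inter> space \<nu> \<in> sets \<nu>" unfolding space_nu
  proof (rule open_in_sets)
    fix \<omega> assume \<omega>: "\<omega> \<in> f -` S \<inter> X"
    then obtain e where e: "0 < e" "\<And>y. \<bar>y - f \<omega>\<bar> < e \<Longrightarrow> y \<in> S"
      using S by (auto simp: open_dist dist_real_def)
    then show "\<exists>n. \<forall>\<upsilon>\<in>X. (\<forall>i<n. \<omega> i = \<upsilon> i) \<longrightarrow> \<upsilon> \<in> f -` S \<inter> X"
      using assms[of \<omega> e] \<omega> by auto
  qed auto
qed

text \<open>The indicator depends on finitely many coordinates, hence is continuous and may be used
  as a test function for the eigenmeasure.\<close>

lemma indicator_cyl_in_Cb: "(\<lambda>\<omega>. indicator (cyl w) \<omega> :: complex) \<in> Cb \<theta> X"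
proof -
  have "continuous_map (top_theta \<theta> X) euclidean (indicator (cyl w) :: _ \<Rightarrow> complex)"
    unfolding continuous_map_def topspace_top_theta[OF theta]
  proof (intro conjI allI impI)
    fix U :: "complex set"
    show "openin (top_theta \<theta> X) {x \<in> X. indicator (cyl w) x \<in> U}"
    proof (rule openin_top_thetaI[OF theta])
      fix \<omega> assume \<omega>: "\<omega> \<in> {x \<in> X. indicator (cyl w) x \<in> U}"
      have "indicator (cyl w) \<upsilon> = (indicator (cyl w) \<omega> :: complex)"
        if "\<upsilon> \<in> X" "\<forall>i<length w. \<omega> i = \<upsilon> i" for \<upsilon>
        using that \<omega> by (auto simp: indicator_def cylinder_def)
      with \<omega> show "\<exists>n. \<forall>\<upsilon>\<in>X. (\<forall>i<n. \<omega> i = \<upsilon> i) \<longrightarrow> \<upsilon> \<in> {x \<in> X. indicator (cyl w) x \<in> U}"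
        by (metis (mono_tags, lifting) mem_Collect_eq)
    qed auto
  qed auto
  moreover have "bounded ((\<lambda>\<omega>. indicator (cyl w) \<omega> :: complex) ` X)"
    by (rule boundedI[of _ 1]) (auto simp: indicator_def)
  moreover have "indicator (cyl w) \<omega> = (0 :: complex)" if "\<omega> \<notin> X" for \<omega>
    using that by (simp add: indicator_def cylinder_def)
  ultimately show ?thesis unfolding Cb_def by blast
qed

text \<open>This is the transfer operator applied to the indicator of the cylinder of
  \<open>b # w\<close>: only the preimage starting with \<open>b\<close> contributes.\<close>

definition "pull b w \<omega> = (if \<omega> \<in> cyl w \<and> A b (\<omega> 0) = 1 then exp (\<phi> (prepend b \<omega>)) else 0)"

lemma prepend_in_cyl:
  assumes "\<omega> \<in> X" "A a (\<omega> 0) = 1"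
  shows "prepend a \<omega> \<in> cyl (b # w) \<longleftrightarrow> a = b \<and> \<omega> \<in> cyl w"
  using assms prepend_in_markov_shift[of \<omega> A a]
  by (subst cyl_Cons) (auto simp: cylinder_def X_def)

lemma transfer_indicator:
  "transfer_op A \<phi> (\<lambda>\<omega>. indicator (cyl (b # w)) \<omega>) = (\<lambda>\<omega>. complex_of_real (pull b w \<omega>))"
proof
  fix \<omega>
  show "transfer_op A \<phi> (\<lambda>\<omega>. indicator (cyl (b # w)) \<omega>) \<omega> = complex_of_real (pull b w \<omega>)"
  proof (cases "\<omega> \<in> X")
    case False
    then show ?thesis by (auto simp: transfer_op_def X_def pull_def cylinder_def)
  next
    case True
    let ?f = "\<lambda>a. complex_of_real (exp (\<phi> (prepend a \<omega>))) * indicator (cyl (b # w)) (prepend a \<omega>)"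
    let ?S = "{a. A a (\<omega> 0) = 1}"
    have "(\<Sum>\<^sub>\<infinity>a\<in>?S. ?f a) = (\<Sum>\<^sub>\<infinity>a\<in>?S \<inter> {b}. ?f a)"
      by (rule infsum_cong_neutral) (auto simp: prepend_in_cyl[OF True] indicator_def)
    also have "\<dots> = complex_of_real (pull b w \<omega>)"
      by (cases "A b (\<omega> 0) = 1") (auto simp: pull_def prepend_in_cyl[OF True] indicator_def)
    finally show ?thesis using True by (simp add: transfer_op_def X_def)
  qed
qed

text \<open>Membership in the cylinder and the allowed transition are decided by finitely many
  coordinates; beyond them, continuity follows from the decay of the variation of
  \<open>\<phi>\<close>.\<close>

lemma pull_measurable: "pull b w \<in> borel_measurable \<nu>"
proof (rule measurable_if_continuous)
  fix \<omega> and e :: real assume \<omega>: "\<omega> \<in> X" and e: "0 < e"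
  have cong: "pull b w \<upsilon> = (if \<omega> \<in> cyl w \<and> A b (\<omega> 0) = 1 then exp (\<phi> (prepend b \<upsilon>)) else 0)"
    if "\<upsilon> \<in> X" "0 < n" "length w \<le> n" "\<forall>i<n. \<omega> i = \<upsilon> i" for \<upsilon> n
    using that \<omega> by (auto simp: pull_def cylinder_def)
  show "\<exists>n. \<forall>\<upsilon>\<in>X. (\<forall>i<n. \<omega> i = \<upsilon> i) \<longrightarrow> \<bar>pull b w \<upsilon> - pull b w \<omega>\<bar> < e"
  proof (cases "\<omega> \<in> cyl w \<and> A b (\<omega> 0) = 1")
    case False
    then show ?thesis using cong[of _ "Suc (length w)"] \<omega> e
      by (intro exI[of _ "Suc (length w)"]) auto
  next
    case True
    have "isCont exp (\<phi> (prepend b \<omega>))" by simp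
    then obtain d where d: "0 < d"
      "\<And>y. \<bar>y - \<phi> (prepend b \<omega>)\<bar> < d \<Longrightarrow> \<bar>exp y - exp (\<phi> (prepend b \<omega>))\<bar> < e"
      using e by (force simp: continuous_at_eps_delta dist_real_def)
    have "(\<lambda>n. lip_const * \<theta> ^ n) \<longlonglongrightarrow> lip_const * 0"
      using theta by (intro tendsto_mult tendsto_const LIMSEQ_power_zero) auto
    then have "eventually (\<lambda>n. lip_const * \<theta> ^ n < d) sequentially"
      using d(1) order_tendstoD(2) by fastforce
    then obtain n0 where n0: "\<And>n. n0 \<le> n \<Longrightarrow> lip_const * \<theta> ^ n < d"
      by (auto simp: eventually_sequentially)
    define n where "n = Suc (n0 + k + length w)"
    have "\<bar>pull b w \<upsilon> - pull b w \<omega>\<bar> < e" if \<upsilon>: "\<upsilon> \<in> X" "\<forall>i<n. \<omega> i = \<upsilon> i" for \<upsilon>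
    proof -
      have "A b (\<upsilon> 0) = 1" using \<upsilon> True by (simp add: n_def)
      then have "prepend b \<upsilon> \<in> X" "prepend b \<omega> \<in> X"
        using \<upsilon> \<omega> True prepend_in_markov_shift[of _ A b] by (auto simp: X_def)
      then have "\<bar>\<phi> (prepend b \<upsilon>) - \<phi> (prepend b \<omega>)\<bar> \<le> lip_const * \<theta> ^ n"
        using \<upsilon> by (intro phi_variation) (auto simp: n_def prepend_def split: nat.splits)
      also have "\<dots> < d" by (rule n0) (simp add: n_def)
      finally have "\<bar>exp (\<phi> (prepend b \<upsilon>)) - exp (\<phi> (prepend b \<omega>))\<bar> < e" by (rule d(2))
      then show ?thesis using cong[of \<upsilon> n] cong[of \<omega> n] \<upsilon> \<omega> True by (simp add: n_def)
    qed
    then show ?thesis by blast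
  qed
qed

lemma pull_integrable: "integrable \<nu> (pull b w)"
proof -
  obtain c where c: "\<And>\<omega>. \<omega> \<in> X \<Longrightarrow> \<phi> \<omega> \<le> c" by (rule phi_bounded_above) blast
  have "\<bar>pull b w \<omega>\<bar> \<le> exp c" if "\<omega> \<in> X" for \<omega>
    using that c[of "prepend b \<omega>"] prepend_in_markov_shift[of \<omega> A b] by (auto simp: pull_def X_def)
  then show ?thesis
    by (intro integrable_const_bound[where B = "exp c"] pull_measurable) (auto simp: space_nu)
qed

lemma nu_cyl_Cons: "lam * prob (cyl (b # w)) = (\<integral>\<omega>. pull b w \<omega> \<partial>\<nu>)"
proof -
  have "complex_of_real (\<integral>\<omega>. pull b w \<omega> \<partial>\<nu>) = (\<integral>\<omega>. complex_of_real (pull b w \<omega>) \<partial>\<nu>)"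
    by (rule integral_complex_of_real[symmetric])
  also have "\<dots> = complex_of_real lam * (\<integral>\<omega>. indicator (cyl (b # w)) \<omega> \<partial>\<nu>)"
    using nu_eigen[OF indicator_cyl_in_Cb[of "b # w"]] by (simp only: transfer_indicator)
  also have "(\<integral>\<omega>. indicator (cyl (b # w)) \<omega> \<partial>\<nu>) = complex_of_real (\<integral>\<omega>. indicator (cyl (b # w)) \<omega> \<partial>\<nu>)"
  proof -
    have "indicator (cyl (b # w)) \<omega> = complex_of_real (indicator (cyl (b # w)) \<omega>)" for \<omega>
      by (simp add: indicator_def)
    then show ?thesis by (simp only: integral_complex_of_real)
  qed
  also have "(\<integral>\<omega>. indicator (cyl (b # w)) \<omega> \<partial>\<nu>) = prob (cyl (b # w))"
    by simp
  finally have "complex_of_real (\<integral>\<omega>. pull b w \<omega> \<partial>\<nu>) = complex_of_real (lam * prob (cyl (b # w)))"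
    by simp
  then show ?thesis by (simp only: of_real_eq_iff)
qed

text \<open>The eigenmeasure identity removes the first letter, at the cost of the supremum of
  \<open>\<phi>\<close> over the current cylinder, which is exactly one factor of the
  weight.\<close>

lemma prob_cyl_upper: "prob (cyl w) \<le> wt w / lam ^ length w"
proof (induction w)
  case Nil
  then show ?case by simp
next
  case (Cons b w)
  let ?s = "SUP \<omega>\<in>cyl (b # w). \<phi> \<omega>"
  have "lam * prob (cyl (b # w)) \<le> (\<integral>\<omega>. exp ?s * indicator (cyl w) \<omega> \<partial>\<nu>)"
    unfolding nu_cyl_Cons
  proof (intro integral_mono pull_integrable)
    fix \<omega> assume "\<omega> \<in> space \<nu>"
    then have X: "\<omega> \<in> X" by (simp add: space_nu)
    show "pull b w \<omega> \<le> exp ?s * indicator (cyl w) \<omega>"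
    proof (cases "\<omega> \<in> cyl w \<and> A b (\<omega> 0) = 1")
      case True
      then have "prepend b \<omega> \<in> cyl (b # w)" using prepend_in_cyl[OF X] by simp
      then have "\<phi> (prepend b \<omega>) \<le> ?s" by (intro cSUP_upper bdd_above_cyl)
      then show ?thesis using True by (simp add: pull_def)
    qed (auto simp: pull_def indicator_def)
  qed auto
  also have "\<dots> = exp ?s * prob (cyl w)" by simp
  also have "\<dots> \<le> exp ?s * (wt w / lam ^ length w)" by (intro mult_left_mono Cons) simp
  finally show ?case using lam_pos by (simp add: field_simps)
qed

text \<open>Converse estimate with a reference point \<open>\<omega>\<close>: prepending
  \<open>b\<close> to any point of the shorter cylinder lands in the same long cylinder as
  \<open>\<omega>\<close>, so \<open>\<phi>\<close> changes by one term of the distortion at each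
  step.\<close>

lemma prob_cyl_lower:
  assumes "\<omega> \<in> cyl (u @ v)" "k \<le> length v"
  shows "exp (birkhoff_sum (length u) \<phi> \<omega> - distortion (length u)) * prob (cyl v) \<le>
           lam ^ length u * prob (cyl (u @ v))"
  using assms(1)
proof (induction u arbitrary: \<omega>)
  case Nil
  then show ?case by (simp add: birkhoff_sum_def distortion_def)
next
  case (Cons b u)
  let ?m = "\<phi> \<omega> - lip_const * \<theta> ^ (k + 1 + length u)"
  have \<omega>: "\<omega> \<in> cyl (b # u @ v)" using Cons.prems by simp
  then have shift: "left_shift \<omega> \<in> cyl (u @ v)" using cyl_Cons by blast
  \<comment> \<open>All points of this cylinder share the letter that follows \<open>b\<close> in
    \<open>\<omega>\<close>; the word is nonempty because \<open>v\<close> has length at least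
    \<open>k\<close>.\<close>
  have A: "A b (\<upsilon> 0) = 1" if "\<upsilon> \<in> cyl (u @ v)" for \<upsilon>
  proof -
    have "0 < length (u @ v)" using assms(2) k_pos by (cases v) auto
    then have "\<upsilon> 0 = left_shift \<omega> 0" using that shift cylinder_agree by blast
    moreover have "\<omega> 0 = b" "\<omega> \<in> X" using \<omega> by (auto simp: cylinder_def)
    ultimately show ?thesis by (auto simp: X_def markov_shift_def left_shift_def)
  qed
  have "(\<integral>\<upsilon>. exp ?m * indicator (cyl (u @ v)) \<upsilon> \<partial>\<nu>) \<le> lam * prob (cyl (b # u @ v))"
    unfolding nu_cyl_Cons
  proof (intro integral_mono pull_integrable)
    fix \<upsilon> assume "\<upsilon> \<in> space \<nu>"
    then have X: "\<upsilon> \<in> X" by (simp add: space_nu)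
    show "exp ?m * indicator (cyl (u @ v)) \<upsilon> \<le> pull b (u @ v) \<upsilon>"
    proof (cases "\<upsilon> \<in> cyl (u @ v)")
      case True
      then have "prepend b \<upsilon> \<in> cyl (b # u @ v)" using prepend_in_cyl[OF X] A by simp
      then have "\<bar>\<phi> (prepend b \<upsilon>) - \<phi> \<omega>\<bar> \<le> lip_const * \<theta> ^ (k + 1 + length u)"
        using \<omega> assms(2) by (intro phi_variation) (auto intro: cyl_in_X cylinder_agree)
      then show ?thesis using True A by (simp add: pull_def)
    qed (simp add: pull_def)
  qed auto
  then have step: "exp ?m * prob (cyl (u @ v)) \<le> lam * prob (cyl (b # u @ v))" by simp
  have "exp (birkhoff_sum (length (b # u)) \<phi> \<omega> - distortion (length (b # u))) * prob (cyl v) =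
     exp ?m * (exp (birkhoff_sum (length u) \<phi> (left_shift \<omega>) - distortion (length u)) * prob (cyl v))"
    by (simp add: birkhoff_sum_Suc distortion_def exp_add exp_diff mult_ac)
  also have "\<dots> \<le> exp ?m * (lam ^ length u * prob (cyl (u @ v)))"
    by (intro mult_left_mono Cons.IH shift) simp
  also have "\<dots> \<le> lam ^ length u * (lam * prob (cyl (b # u @ v)))"
    using mult_left_mono[OF step, of "lam ^ length u"] lam_pos by (simp add: mult_ac less_imp_le)
  finally show ?case by (simp add: mult_ac)
qed

section \<open>Bounds for the eigenfunction\<close>

lemma prepend_word:
  assumes "\<omega> \<in> X" "successively (\<lambda>i j. A i j = 1) u" "u \<noteq> [] \<Longrightarrow> A (last u) (\<omega> 0) = 1"
  shows "\<exists>\<upsilon>\<in>cyl u. (left_shift ^^ length u) \<upsilon> = \<omega>"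
  using assms
proof (induction u arbitrary: \<omega> rule: rev_induct)
  case Nil
  then show ?case by auto
next
  case (snoc b u)
  let ?\<omega> = "prepend b \<omega>"
  have "?\<omega> \<in> X" using snoc.prems prepend_in_markov_shift[of \<omega> A b] by (auto simp: X_def)
  moreover have "u \<noteq> [] \<Longrightarrow> A (last u) (?\<omega> 0) = 1" "successively (\<lambda>i j. A i j = 1) u"
    using snoc.prems by (auto simp: successively_append_iff)
  ultimately obtain \<upsilon> where \<upsilon>: "\<upsilon> \<in> cyl u" "(left_shift ^^ length u) \<upsilon> = ?\<omega>"
    using snoc.IH by blast
  have "?\<omega> \<in> cyl [b]" using \<open>?\<omega> \<in> X\<close> by (simp add: cylinder_def)
  with \<upsilon> have "\<upsilon> \<in> cyl (u @ [b])" by (simp add: cyl_append)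
  moreover have "(left_shift ^^ length (u @ [b])) \<upsilon> = \<omega>" using \<upsilon> by simp
  ultimately show ?case by blast
qed

lemma connecting_word:
  assumes "cyl v \<noteq> {}" "v \<noteq> []"
  obtains y where "\<And>\<omega>. \<omega> \<in> X \<Longrightarrow> \<omega> 0 = b \<Longrightarrow> \<exists>\<upsilon>\<in>cyl (v @ y). (left_shift ^^ length (v @ y)) \<upsilon> = \<omega>"
proof -
  obtain n w where w: "1 \<le> n" "length w = n + 1" "w ! 0 = last v" "w ! n = b"
    "\<forall>i<n. A (w ! i) (w ! (i + 1)) = 1"
    using irreducible unfolding irreducible_matrix_def by blast
  \<comment> \<open>\<open>y\<close> is the interior of the connecting path: its first vertex is
    already the last letter of \<open>v\<close>, and its end is the first letter of
    \<open>\<omega>\<close>. It is empty when \<open>n = 1\<close>.\<close>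
  define y where "y = map (\<lambda>i. w ! Suc i) [0..<n - 1]"
  obtain \<upsilon> where "\<upsilon> \<in> cyl v" using assms by blast
  then have "v = map \<upsilon> [0..<length v]" "\<upsilon> \<in> X" by (auto simp: cylinder_def intro: nth_equalityI)
  then have v: "successively (\<lambda>i j. A i j = 1) v"
    using successively_prefix[of \<upsilon> UNIV A "length v"] by (simp add: X_def)
  have y: "successively (\<lambda>i j. A i j = 1) y"
    using w by (auto simp: y_def successively_conv_nth)
  have hd: "y \<noteq> [] \<Longrightarrow> A (last v) (hd y) = 1"
    using w by (auto simp: y_def hd_map)
  have last: "A (last (v @ y)) b = 1"
  proof (cases "n = 1")
    case True
    then show ?thesis using w by (auto simp: y_def)
  next
    case False
    have "Suc (n - Suc (Suc 0)) = n - Suc 0" using False w(1) by arith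
    with False have "last (v @ y) = w ! (n - 1)"
      using w(1) by (auto simp: y_def last_map last_append)
    then show ?thesis using w(1,4) w(5)[rule_format, of "n - 1"] by simp
  qed
  have "successively (\<lambda>i j. A i j = 1) (v @ y)"
    using v y hd by (auto simp: successively_append_iff)
  then show ?thesis using last by (intro that[of y] prepend_word) auto
qed

text \<open>Countably many cylinders of length \<open>k\<close> cover \<open>X\<close>, so one of
  them, that of \<open>w\<close>, has positive measure. Connecting \<open>v\<close> to
  \<open>w\<close> and applying \<open>prob_cyl_lower\<close> puts positive measure inside the
  cylinder of \<open>v\<close>.\<close>

lemma prob_cyl_pos:
  assumes "cyl v \<noteq> {}" "v \<noteq> []"
  shows "0 < prob (cyl v)"
proof -
  have "X = (\<Union>w\<in>{w. length w = k}. cyl w)"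
  proof (intro equalityI subsetI)
    fix \<omega> assume "\<omega> \<in> X"
    then show "\<omega> \<in> (\<Union>w\<in>{w. length w = k}. cyl w)"
      by (intro UN_I[of "map \<omega> [0..<k]"] mem_cylinder_prefix) auto
  qed (auto dest: cyl_in_X)
  then have "(\<Union>w\<in>{w. length w = k}. cyl w) \<notin> null_sets \<nu>"
    using prob_space space_nu by (auto simp: null_sets_def measure_def)
  then obtain w where w: "length w = k" "cyl w \<notin> null_sets \<nu>"
    using null_sets_UN'[of "{w :: 's list. length w = k}" cyl \<nu>] by auto
  then have pos: "0 < prob (cyl w)"
    by (metis cyl_sets emeasure_eq_measure ennreal_0 null_setsI zero_less_measure_iff)
  then have "cyl w \<noteq> {}" by auto
  then obtain \<omega> where \<omega>: "\<omega> \<in> cyl w" by blast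
  obtain y where y: "\<And>\<omega>'. \<omega>' \<in> X \<Longrightarrow> \<omega>' 0 = \<omega> 0 \<Longrightarrow>
      \<exists>\<upsilon>\<in>cyl (v @ y). (left_shift ^^ length (v @ y)) \<upsilon> = \<omega>'"
    by (rule connecting_word[OF assms]) blast
  then obtain \<upsilon> where "\<upsilon> \<in> cyl (v @ y)" "(left_shift ^^ length (v @ y)) \<upsilon> = \<omega>"
    using \<omega> cyl_in_X by blast
  then have "\<upsilon> \<in> cyl ((v @ y) @ w)" using \<omega> cyl_append by blast
  then have "exp (birkhoff_sum (length (v @ y)) \<phi> \<upsilon> - distortion (length (v @ y))) * prob (cyl w)
      \<le> lam ^ length (v @ y) * prob (cyl ((v @ y) @ w))"
    using w(1) by (intro prob_cyl_lower) auto
  moreover have "0 < exp (birkhoff_sum (length (v @ y)) \<phi> \<upsilon> - distortion (length (v @ y))) * prob (cyl w)"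
    using pos by simp
  ultimately have "0 < lam ^ length (v @ y) * prob (cyl ((v @ y) @ w))" by linarith
  then have "0 < prob (cyl (v @ y @ w))" by (simp add: zero_less_mult_iff)
  also have "\<dots> \<le> prob (cyl v)" by (intro finite_measure_mono cylinder_append_subset) simp
  finally show ?thesis .
qed

lemma h_bounded: obtains H where "0 < H" "\<And>\<omega>. \<omega> \<in> X \<Longrightarrow> h \<omega> \<le> H"
proof -
  have "bounded ((\<lambda>\<omega>. complex_of_real (h \<omega>)) ` X)" using h_in_Fb by (simp add: Fb_def Cb_def)
  then obtain H where "0 < H" "\<forall>x\<in>X. norm (complex_of_real (h x)) \<le> H"
    unfolding bounded_pos by auto
  then show ?thesis by (intro that[of H]) auto
qed

text \<open>\<open>\<upsilon>\<close> is one of the preimages of its shift, and the other terms of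
  the eigenvalue equation are nonnegative.\<close>

lemma h_step:
  assumes "\<upsilon> \<in> X"
  shows "exp (\<phi> \<upsilon>) * h \<upsilon> \<le> lam * h (left_shift \<upsilon>)"
proof -
  let ?\<omega> = "left_shift \<upsilon>"
  let ?S = "{a. A a (?\<omega> 0) = 1}"
  let ?f = "\<lambda>a. exp (\<phi> (prepend a ?\<omega>)) * h (prepend a ?\<omega>)"
  have X: "?\<omega> \<in> X" using shift_X[OF assms, of 1] by simp
  have in_X: "prepend a ?\<omega> \<in> X" if "a \<in> ?S" for a
    using that X prepend_in_markov_shift[of ?\<omega> A a] by (simp add: X_def)
  obtain H where H: "0 < H" "\<And>\<omega>. \<omega> \<in> X \<Longrightarrow> h \<omega> \<le> H" by (rule h_bounded) blast
  have nonneg: "0 \<le> ?f a" if "a \<in> ?S" for a using in_X[OF that] h_nonneg by simp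
  have le: "?f a \<le> H * WM [a]" if "a \<in> ?S" for a
  proof -
    have *: "prepend a ?\<omega> \<in> cyl [a]" using in_X[OF that] by (simp add: cylinder_def)
    then have "exp (\<phi> (prepend a ?\<omega>)) \<le> wt [a]"
      using exp_birkhoff_le_wt[OF *] by (simp add: birkhoff_sum_def)
    also have "wt [a] = WM [a]" using * by (auto simp: WM_def)
    finally have "?f a \<le> WM [a] * H"
      using H in_X[OF that] h_nonneg by (intro mult_mono) (auto simp: WM.W_nonneg)
    then show ?thesis by (simp add: mult.commute)
  qed
  \<comment> \<open>Summability has to be proved, as \<open>infsum\<close> defaults to
    \<open>0\<close> otherwise; the letter weights times a bound for \<open>h\<close>
    dominate.\<close>
  have sm: "?f summable_on ?S"
  proof (rule summable_on_comparison_test[OF _ le nonneg])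
    show "(\<lambda>a. H * WM [a]) summable_on ?S"
      by (intro summable_on_cmult_right summable_on_subset[OF summable_letters]) auto
  qed
  have "complex_of_real (lam * h ?\<omega>) = (\<Sum>\<^sub>\<infinity>a\<in>?S. complex_of_real (?f a))"
    using h_eigen[OF X] X by (simp add: transfer_op_def X_def)
  also have "\<dots> = complex_of_real (\<Sum>\<^sub>\<infinity>a\<in>?S. ?f a)"
    by (rule infsumI) (rule has_sum_of_real[OF has_sum_infsum[OF sm]])
  finally have eq: "lam * h ?\<omega> = (\<Sum>\<^sub>\<infinity>a\<in>?S. ?f a)" by (simp only: of_real_eq_iff)
  have "\<upsilon> 0 \<in> ?S" using assms by (simp add: X_def markov_shift_def left_shift_def)
  then have "(\<Sum>a\<in>{\<upsilon> 0}. ?f a) \<le> (\<Sum>\<^sub>\<infinity>a\<in>?S. ?f a)"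
    using nonneg by (intro sum_le_infsum_subset sm) auto
  then show ?thesis by (simp add: eq prepend_left_shift)
qed

lemma h_iterate:
  "\<upsilon> \<in> X \<Longrightarrow> exp (birkhoff_sum n \<phi> \<upsilon>) * h \<upsilon> \<le> lam ^ n * h ((left_shift ^^ n) \<upsilon>)"
proof (induction n arbitrary: \<upsilon>)
  case 0
  then show ?case by (simp add: birkhoff_sum_def)
next
  case (Suc n)
  have X: "left_shift \<upsilon> \<in> X" using shift_X[OF Suc.prems, of 1] by simp
  have "exp (birkhoff_sum (Suc n) \<phi> \<upsilon>) * h \<upsilon> = exp (birkhoff_sum n \<phi> (left_shift \<upsilon>)) * (exp (\<phi> \<upsilon>) * h \<upsilon>)"
    by (simp add: birkhoff_sum_Suc exp_add)
  also have "\<dots> \<le> exp (birkhoff_sum n \<phi> (left_shift \<upsilon>)) * (lam * h (left_shift \<upsilon>))"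
    by (intro mult_left_mono h_step Suc.prems) simp
  also have "\<dots> = lam * (exp (birkhoff_sum n \<phi> (left_shift \<upsilon>)) * h (left_shift \<upsilon>))" by simp
  also have "\<dots> \<le> lam * (lam ^ n * h ((left_shift ^^ n) (left_shift \<upsilon>)))"
    by (intro mult_left_mono Suc.IH X) (simp add: less_imp_le)
  finally show ?case by (simp add: funpow_swap1)
qed

text \<open>\<open>h\<close> is positive somewhere since its integral is \<open>1\<close>, and by
  continuity it stays at least half as large on a cylinder. One connecting word \<open>u\<close>
  leads from there to every point of the cylinder of \<open>a\<close>, and \<open>h_iterate\<close>
  carries the bound forward.\<close>

lemma h_lower_bound:
  assumes "length a = k" "cyl a \<noteq> {}"
  obtains \<delta> where "0 < \<delta>" "\<And>\<omega>. \<omega> \<in> cyl a \<Longrightarrow> \<delta> \<le> h \<omega>"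
proof -
  have "\<exists>x\<in>X. 0 < h x"
  proof (rule ccontr)
    assume "\<not> ?thesis"
    then have "h x = 0" if "x \<in> X" for x using h_nonneg[OF that] that by force
    then have "(\<integral>\<omega>. h \<omega> \<partial>\<nu>) = (\<integral>\<omega>. 0 \<partial>\<nu>)"
      by (intro Bochner_Integration.integral_cong) (auto simp: space_nu)
    with integral_h show False by simp
  qed
  then obtain x where x: "x \<in> X" "0 < h x" by blast
  obtain C where C: "0 \<le> C" "\<And>n \<omega> \<upsilon>. k \<le> n \<Longrightarrow> \<omega> \<in> X \<Longrightarrow> \<upsilon> \<in> X \<Longrightarrow> (\<And>i. i < n \<Longrightarrow> \<omega> i = \<upsilon> i) \<Longrightarrow>
       norm (complex_of_real (h \<omega>) - complex_of_real (h \<upsilon>)) \<le> C * \<theta> ^ n"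
    using h_in_Fb lip_seminorm_finiteD[OF theta(1), of X k "\<lambda>\<omega>. complex_of_real (h \<omega>)"]
    unfolding Fb_def by blast
  have "(\<lambda>n. C * \<theta> ^ n) \<longlonglongrightarrow> C * 0"
    using theta by (intro tendsto_mult tendsto_const LIMSEQ_power_zero) auto
  then have "eventually (\<lambda>n. C * \<theta> ^ n < h x / 2) sequentially"
    using x(2) order_tendstoD(2)[of _ "C * 0" _ "h x / 2"] by simp
  then have "eventually (\<lambda>n. C * \<theta> ^ n < h x / 2 \<and> k \<le> n) sequentially"
    using eventually_ge_at_top by (rule eventually_conj)
  then obtain n where n: "C * \<theta> ^ n < h x / 2" "k \<le> n"
    by (auto simp: eventually_sequentially)
  define v where "v = map x [0..<n]"
  have xv: "x \<in> cyl v" unfolding v_def by (rule mem_cylinder_prefix[OF x(1)])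
  have h_v: "h x / 2 \<le> h \<upsilon>" if "\<upsilon> \<in> cyl v" for \<upsilon>
  proof -
    have "norm (complex_of_real (h x) - complex_of_real (h \<upsilon>)) \<le> C * \<theta> ^ n"
      using that x(1) n(2) by (intro C) (auto simp: cylinder_def v_def)
    then have "\<bar>h x - h \<upsilon>\<bar> \<le> C * \<theta> ^ n" by (metis norm_of_real of_real_diff)
    with n(1) show ?thesis by linarith
  qed
  have "cyl v \<noteq> {}" "v \<noteq> []" using xv n(2) k_pos by (auto simp: v_def)
  then obtain y where y: "\<And>\<omega>. \<omega> \<in> X \<Longrightarrow> \<omega> 0 = a ! 0 \<Longrightarrow>
      \<exists>\<upsilon>\<in>cyl (v @ y). (left_shift ^^ length (v @ y)) \<upsilon> = \<omega>"
    by (rule connecting_word) blast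
  define u where "u = v @ y"
  \<comment> \<open>The first quotient bounds the exponential Birkhoff sum along \<open>u\<close>
    from below, uniformly on the cylinder of \<open>u @ a\<close>, by bounded distortion.\<close>
  define \<delta> where "\<delta> = wt (u @ a) / (exp (distortion (length u)) * wt a) * (h x / 2) / lam ^ length u"
  show ?thesis
  proof (rule that)
    show "0 < \<delta>" using x(2) lam_pos by (simp add: \<delta>_def)
    fix \<omega> assume \<omega>: "\<omega> \<in> cyl a"
    then have "\<omega> \<in> X" "\<omega> 0 = a ! 0" using assms(1) k_pos by (auto simp: cylinder_def)
    then obtain \<upsilon> where \<upsilon>: "\<upsilon> \<in> cyl u" "(left_shift ^^ length u) \<upsilon> = \<omega>"
      using y unfolding u_def by blast
    then have "\<upsilon> \<in> cyl (u @ a)" using \<omega> cyl_append by blast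
    from wt_le_exp_birkhoff[OF this] assms(1)
    have "wt (u @ a) / (exp (distortion (length u)) * wt a) \<le> exp (birkhoff_sum (length u) \<phi> \<upsilon>)"
      by (simp add: exp_add divide_le_eq mult_ac)
    moreover have "h x / 2 \<le> h \<upsilon>"
      using \<upsilon>(1) cylinder_append_subset[of X v y] by (intro h_v) (auto simp: u_def)
    ultimately have "wt (u @ a) / (exp (distortion (length u)) * wt a) * (h x / 2) \<le>
        exp (birkhoff_sum (length u) \<phi> \<upsilon>) * h \<upsilon>"
      using x(2) by (intro mult_mono) auto
    also have "\<dots> \<le> lam ^ length u * h \<omega>"
      using h_iterate[OF cyl_in_X[OF \<upsilon>(1)], of "length u"] \<upsilon>(2) by simp
    finally show "\<delta> \<le> h \<omega>" using lam_pos by (simp add: \<delta>_def divide_le_eq mult_ac)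
  qed
qed

text \<open>A non-integrable function would have integral \<open>0\<close> by default, contradicting
  the normalisation to \<open>1\<close>.\<close>

lemma h_measurable [measurable]: "h \<in> borel_measurable \<nu>"
proof -
  have "integrable \<nu> h"
  proof (rule ccontr)
    assume "\<not> integrable \<nu> h"
    then have "(\<integral>\<omega>. h \<omega> \<partial>\<nu>) = 0" by (rule not_integrable_integral_eq)
    with integral_h show False by simp
  qed
  then show ?thesis by (rule borel_measurable_integrable)
qed

section \<open>The measure with density \<open>h\<close>\<close>

definition "\<mu> = density \<nu> (\<lambda>\<omega>. ennreal (h \<omega>))"

lemma
  assumes "E \<in> sets \<nu>" "\<And>\<omega>. \<omega> \<in> X \<Longrightarrow> h \<omega> \<le> H" "0 < H"
  shows emeasure_mu_upper: "emeasure \<mu> E \<le> ennreal (H * prob E)"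
    and measure_mu_upper: "measure \<mu> E \<le> H * prob E"
proof -
  have "emeasure \<mu> E = (\<integral>\<^sup>+\<omega>. ennreal (h \<omega>) * indicator E \<omega> \<partial>\<nu>)"
    unfolding \<mu>_def using assms(1) by (intro emeasure_density) auto
  also have "\<dots> \<le> (\<integral>\<^sup>+\<omega>. ennreal H * indicator E \<omega> \<partial>\<nu>)"
    using assms by (intro nn_integral_mono mult_right_mono ennreal_leI) (auto simp: space_nu)
  also have "\<dots> = ennreal H * emeasure \<nu> E"
    using assms(1) by (rule nn_integral_cmult_indicator)
  also have "\<dots> = ennreal (H * prob E)"
    using assms(3) by (simp add: emeasure_eq_measure ennreal_mult less_imp_le)
  finally show *: "emeasure \<mu> E \<le> ennreal (H * prob E)" .
  show "measure \<mu> E \<le> H * prob E"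
    unfolding measure_def[of \<mu>] using * assms(3) by (intro enn2real_leI) (auto intro!: mult_nonneg_nonneg)
qed

lemma measure_mu_lower:
  assumes "E \<in> sets \<nu>" "F \<in> sets \<nu>" "F \<subseteq> E" "0 < \<delta>" "\<And>\<omega>. \<omega> \<in> F \<Longrightarrow> \<delta> \<le> h \<omega>"
  shows "\<delta> * prob F \<le> measure \<mu> E"
proof -
  obtain H where H: "0 < H" "\<And>\<omega>. \<omega> \<in> X \<Longrightarrow> h \<omega> \<le> H" by (rule h_bounded) blast
  have "ennreal (\<delta> * prob F) = ennreal \<delta> * emeasure \<nu> F"
    using assms(4) by (simp add: emeasure_eq_measure ennreal_mult less_imp_le)
  also have "\<dots> = (\<integral>\<^sup>+\<omega>. ennreal \<delta> * indicator F \<omega> \<partial>\<nu>)"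
    using assms(2) by (rule nn_integral_cmult_indicator[symmetric])
  also have "\<dots> \<le> (\<integral>\<^sup>+\<omega>. ennreal (h \<omega>) * indicator E \<omega> \<partial>\<nu>)"
    using assms by (intro nn_integral_mono) (auto simp: indicator_def intro: ennreal_leI)
  also have "\<dots> = emeasure \<mu> E"
    unfolding \<mu>_def using assms(1) by (intro emeasure_density[symmetric]) auto
  \<comment> \<open>Boundedness of \<open>h\<close> makes the measure of \<open>E\<close> finite, so
    \<open>measure\<close> does not fall back to its default \<open>0\<close>.\<close>
  also have "\<dots> = ennreal (measure \<mu> E)"
  proof (rule emeasure_eq_ennreal_measure)
    show "emeasure \<mu> E \<noteq> \<top>"
      using emeasure_mu_upper[OF assms(1) H(2) H(1)] by (metis ennreal_neq_top neq_top_trans)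
  qed
  finally show ?thesis using measure_nonneg ennreal_le_iff by blast
qed

section \<open>The measure of the admissible set\<close>

abbreviation "E n \<equiv> Sigma_M_upto X M n"

text \<open>The times \<open>0\<close> to \<open>n\<close> involve \<open>n + 1\<close> transitions
  and hence \<open>n + 2\<close> letters.\<close>

lemma Sigma_M_upto_eq: "E n = (\<Union>w\<in>{w. length w = n + 2 \<and> admissible w}. cyl w)"
proof (intro equalityI subsetI)
  fix \<omega> assume *: "\<omega> \<in> E n"
  then have X: "\<omega> \<in> X" by (auto simp: Sigma_M_upto_def)
  have "M (\<omega> i) (\<omega> (Suc i)) = 1" if "i \<le> n" for i
  proof -
    have "(left_shift ^^ i) \<omega> \<in> Sigma_M X M" using * that by (simp add: Sigma_M_upto_def)
    then obtain a b where ab: "M a b = 1" "(left_shift ^^ i) \<omega> \<in> cyl [a, b]"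
      unfolding Sigma_M_def by blast
    then have "\<forall>j<2. \<omega> (i + j) = [a, b] ! j" by (simp add: cylinder_def left_shift_funpow numeral_2_eq_2)
    from this[rule_format, of 0] this[rule_format, of 1] ab(1) show ?thesis by simp
  qed
  then have "admissible (map \<omega> [0..<n + 2])"
    by (auto simp: successively_conv_nth nth_append simp del: upt_Suc)
  then show "\<omega> \<in> (\<Union>w\<in>{w. length w = n + 2 \<and> admissible w}. cyl w)"
    using mem_cylinder_prefix[OF X, of "n + 2"] by (intro UN_I[of "map \<omega> [0..<n + 2]"]) auto
next
  fix \<omega> assume "\<omega> \<in> (\<Union>w\<in>{w. length w = n + 2 \<and> admissible w}. cyl w)"
  then obtain w where w: "length w = n + 2" "admissible w" "\<omega> \<in> cyl w" by blast
  have "(left_shift ^^ i) \<omega> \<in> Sigma_M X M" if "i \<le> n" for i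
  proof -
    have "M (\<omega> i) (\<omega> (Suc i)) = 1"
      using w that by (auto simp: successively_conv_nth cylinder_def)
    moreover have "(left_shift ^^ i) \<omega> \<in> X" by (intro shift_X cyl_in_X[OF w(3)])
    ultimately have "(left_shift ^^ i) \<omega> \<in> cyl [\<omega> i, \<omega> (Suc i)]"
      by (auto simp: cylinder_def left_shift_funpow less_Suc_eq)
    with \<open>M (\<omega> i) (\<omega> (Suc i)) = 1\<close> show ?thesis unfolding Sigma_M_def by blast
  qed
  then show "\<omega> \<in> E n" using w(3) cyl_in_X by (auto simp: Sigma_M_upto_def)
qed

lemma E_sets [simp]: "E n \<in> sets \<nu>"
  unfolding Sigma_M_upto_eq by (intro sets.countable_UN') auto

text \<open>A union bound over admissible words, with cylinder measures replaced by weights. Since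
  the bound on \<open>WM\<close> concerns finite families, the words are exhausted through their
  codes \<open>to_nat\<close>, and continuity from below gives the limit.\<close>

lemma prob_E_upper:
  assumes "growth_rate < r"
  obtains C where "0 < C" "\<And>n. prob (E n) \<le> C * r ^ (n + 2) / lam ^ (n + 2)"
proof -
  obtain C where C: "0 < C" "\<And>n F. finite F \<Longrightarrow> F \<subseteq> {w. length w = n} \<Longrightarrow> sum WM F \<le> C * r ^ n"
    by (rule sum_WM_upper[OF assms]) blast
  have "prob (E n) \<le> C * r ^ (n + 2) / lam ^ (n + 2)" for n
  proof -
    define V where "V = (\<lambda>i. {w :: 's list. length w = n + 2 \<and> admissible w \<and> to_nat w < i})"
    have fin: "finite (V i)" for i
    proof (rule finite_subset)
      show "V i \<subseteq> to_nat -` {..<i}" by (auto simp: V_def)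
      show "finite (to_nat -` {..<i} :: 's list set)" by (intro finite_vimageI) auto
    qed
    have E: "E n = (\<Union>i. \<Union>w\<in>V i. cyl w)"
      unfolding Sigma_M_upto_eq V_def by auto
    have "(\<lambda>i. prob (\<Union>w\<in>V i. cyl w)) \<longlonglongrightarrow> prob (E n)"
      unfolding E
    proof (rule finite_Lim_measure_incseq)
      show "range (\<lambda>i. \<Union>w\<in>V i. cyl w) \<subseteq> sets \<nu>" using fin by auto
      show "incseq (\<lambda>i. \<Union>w\<in>V i. cyl w)" by (force simp: incseq_def V_def)
    qed
    moreover have "prob (\<Union>w\<in>V i. cyl w) \<le> C * r ^ (n + 2) / lam ^ (n + 2)" for i
    proof -
      have "prob (\<Union>w\<in>V i. cyl w) \<le> (\<Sum>w\<in>V i. prob (cyl w))"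
        using fin by (intro finite_measure_subadditive_finite) auto
      also have "\<dots> \<le> (\<Sum>w\<in>V i. WM w / lam ^ (n + 2))"
      proof (intro sum_mono)
        fix w assume w: "w \<in> V i"
        show "prob (cyl w) \<le> WM w / lam ^ (n + 2)"
          using w prob_cyl_upper[of w] by (cases "cyl w = {}") (auto simp: V_def WM_def)
      qed
      also have "\<dots> = sum WM (V i) / lam ^ (n + 2)" by (simp add: sum_divide_distrib)
      also have "\<dots> \<le> C * r ^ (n + 2) / lam ^ (n + 2)"
        using fin by (intro divide_right_mono C) (auto simp: V_def less_imp_le)
      finally show ?thesis .
    qed
    ultimately show ?thesis by (intro LIMSEQ_le_const2) auto
  qed
  with C(1) show ?thesis by (rule that)
qed

lemma mu_E_upper:
  assumes "growth_rate / lam < s"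
  shows "\<exists>C>0. \<forall>n. measure \<mu> (E n) \<le> C * s ^ n"
proof -
  define r where "r = s * lam"
  have s: "0 < s" using assms growth_rate_pos by (smt (verit) divide_pos_pos lam_pos)
  have "growth_rate < r" using assms by (simp add: r_def divide_less_eq)
  then obtain C where C: "0 < C" "\<And>n. prob (E n) \<le> C * r ^ (n + 2) / lam ^ (n + 2)"
    by (rule prob_E_upper) blast
  obtain H where H: "0 < H" "\<And>\<omega>. \<omega> \<in> X \<Longrightarrow> h \<omega> \<le> H" by (rule h_bounded) blast
  \<comment> \<open>The factor \<open>s ^ 2\<close> accounts for the two letters beyond
    \<open>n\<close>.\<close>
  have "measure \<mu> (E n) \<le> H * C * s ^ 2 * s ^ n" for n
  proof -
    have "measure \<mu> (E n) \<le> H * prob (E n)" by (rule measure_mu_upper[OF E_sets H(2) H(1)])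
    also have "\<dots> \<le> H * (C * r ^ (n + 2) / lam ^ (n + 2))"
      using C H by (intro mult_left_mono) auto
    also have "\<dots> = H * C * (r / lam) ^ (n + 2)"
      by (simp only: power_divide times_divide_eq_right mult.assoc)
    also have "\<dots> = H * C * s ^ 2 * s ^ n"
    proof -
      have "r / lam = s"
        unfolding r_def by (rule nonzero_mult_div_cancel_right) (rule less_imp_neq[OF lam_pos, symmetric])
      then show ?thesis by (simp add: power_add power2_eq_square)
    qed
    finally show ?thesis .
  qed
  moreover have "0 < H * C * s ^ 2" using H C s by simp
  ultimately show ?thesis by blast
qed

text \<open>For a fixed number of loops the cylinders are disjoint, and each has measure at least a
  constant times \<open>lam\<close> to minus its loop length times the product of \<open>p\<close>.
  The additional loop in \<open>Suc j\<close> makes the cylinders reach beyond time \<open>n\<close>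
  later; its factor is absorbed in \<open>c\<close>.\<close>

lemma prob_loop_cylinders_lower:
  assumes sys: "loop_system a N L p"
  obtains c where "0 < c" "\<And>j. c * (sum p L / lam ^ N) ^ j \<le>
    prob (\<Union>\<tau>\<in>{\<tau>. set \<tau> \<subseteq> L \<and> length \<tau> = Suc j}. cyl (concat \<tau> @ a))"
proof -
  have a: "length a = k" "k \<le> N" "finite L" "L \<noteq> {}" using sys by (auto simp: loop_system_def)
  have p_pos: "0 < p w" if "w \<in> L" for w using sys that by (auto simp: loop_system_def)
  have ne: "cyl (concat \<tau> @ a) \<noteq> {}" if "set \<tau> \<subseteq> L" "\<tau> \<noteq> []" for \<tau>
  proof -
    have len: "k \<le> length (concat \<tau>)"
      using length_loop_concat[OF sys that(1)] a(2) that(2) by (cases \<tau>) auto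
    have "take k (concat \<tau>) = a"
      using loop_concat_prefix[OF sys that(1)] len by simp
    from periodic_point_in_cylinder[OF admissible_loop_concat[OF sys that(1)] this a(1) len]
    show ?thesis by blast
  qed
  obtain w0 where w0: "w0 \<in> L" using a(4) by blast
  have "cyl (w0 @ a) \<noteq> {}" using ne[of "[w0]"] w0 by simp
  then have "cyl a \<noteq> {}" using cyl_append by blast
  moreover have "a \<noteq> []" using a(1) k_pos by auto
  ultimately have pos: "0 < prob (cyl a)" by (rule prob_cyl_pos)
  define q where "q = sum p L / lam ^ N"
  have q: "0 < q" using a p_pos by (auto simp: q_def intro!: sum_pos divide_pos_pos)
  define c where "c = exp (- max_distortion) * prob (cyl a) * q"
  have "c * q ^ j \<le> prob (\<Union>\<tau>\<in>{\<tau>. set \<tau> \<subseteq> L \<and> length \<tau> = Suc j}. cyl (concat \<tau> @ a))" for j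
  proof -
    define T where "T = {\<tau>. set \<tau> \<subseteq> L \<and> length \<tau> = Suc j}"
    have finT: "finite T" unfolding T_def using a(3) by (rule finite_lists_length_eq)
    have each: "exp (- max_distortion) * prob (cyl a) / lam ^ (N * Suc j) * prod_list (map p \<tau>)
        \<le> prob (cyl (concat \<tau> @ a))" if "\<tau> \<in> T" for \<tau>
    proof -
      have \<tau>: "set \<tau> \<subseteq> L" "length \<tau> = Suc j" using that by (auto simp: T_def)
      obtain \<omega> where \<omega>: "\<omega> \<in> cyl (concat \<tau> @ a)" using ne[OF \<tau>(1)] \<tau>(2) by fastforce
      have len: "length (concat \<tau>) = N * Suc j"
        using length_loop_concat[OF sys \<tau>(1)] \<tau>(2) by (simp add: mult.commute)
      have "prod_list (map p \<tau>) * exp (- max_distortion) \<le>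
          exp (birkhoff_sum (N * Suc j) \<phi> \<omega>) * exp (- distortion (N * Suc j))"
        using prod_le_exp_birkhoff[OF sys \<tau>(1) \<omega>] \<tau>(2) distortion_le
        by (intro mult_mono) (auto simp: mult.commute)
      then have "prod_list (map p \<tau>) * exp (- max_distortion) * prob (cyl a) \<le>
          exp (birkhoff_sum (N * Suc j) \<phi> \<omega> - distortion (N * Suc j)) * prob (cyl a)"
        by (intro mult_right_mono) (auto simp: exp_diff exp_minus divide_inverse)
      also have "\<dots> \<le> lam ^ (N * Suc j) * prob (cyl (concat \<tau> @ a))"
        using prob_cyl_lower[OF \<omega>] a(1) len by simp
      finally show ?thesis using lam_pos by (simp add: divide_le_eq mult_ac)
    qed
    have "c * q ^ j = exp (- max_distortion) * prob (cyl a) / lam ^ (N * Suc j) * sum p L ^ Suc j"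
      using lam_pos by (simp add: c_def q_def power_mult[symmetric] power_add field_simps)
    also have "\<dots> = (\<Sum>\<tau>\<in>T. exp (- max_distortion) * prob (cyl a) / lam ^ (N * Suc j) * prod_list (map p \<tau>))"
      unfolding T_def by (subst sum_prod_list_lists[OF a(3), symmetric]) (simp add: sum_distrib_left)
    also have "\<dots> \<le> (\<Sum>\<tau>\<in>T. prob (cyl (concat \<tau> @ a)))" by (intro sum_mono each)
    also have "\<dots> = prob (\<Union>\<tau>\<in>T. cyl (concat \<tau> @ a))"
    proof (rule finite_measure_finite_Union[symmetric])
      show "disjoint_family_on (\<lambda>\<tau>. cyl (concat \<tau> @ a)) T"
        unfolding disjoint_family_on_def
      proof (intro ballI impI)
        fix \<tau> \<tau>' assume *: "\<tau> \<in> T" "\<tau>' \<in> T" "\<tau> \<noteq> \<tau>'"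
        then have "concat \<tau> \<noteq> concat \<tau>'"
          using concat_loops_inj[OF sys, of "Suc j"] unfolding T_def inj_on_def by blast
        moreover have "length (concat \<tau>) = length (concat \<tau>')"
          using * length_loop_concat[OF sys] by (simp add: T_def)
        ultimately show "cyl (concat \<tau> @ a) \<inter> cyl (concat \<tau>' @ a) = {}"
          by (intro cylinder_disjoint) auto
      qed
    qed (use finT in auto)
    finally show ?thesis unfolding T_def .
  qed
  moreover have "0 < c" using pos q by (simp add: c_def)
  ultimately show ?thesis using that unfolding q_def by blast
qed

text \<open>The loop cylinders lie both in the admissible set and in the cylinder of
  \<open>a\<close>, where \<open>h\<close> is bounded below, so their eigenmeasure transfers to
  \<open>\<mu>\<close> up to a constant.\<close>

lemma mu_E_lower:
  assumes s: "0 < s" "s < growth_rate / lam"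
  shows "\<exists>c>0. \<forall>n. c * s ^ n \<le> measure \<mu> (E n)"
proof -
  define r where "r = s * lam"
  have r: "0 < r" "r < growth_rate" using s by (auto simp: r_def less_divide_eq)
  obtain a N L p where sys: "loop_system a N L p" and sum_p: "r ^ N \<le> sum p L"
    by (rule exists_loop_system[OF r])
  have a: "length a = k" "k \<le> N" "finite L" "L \<noteq> {}" using sys by (auto simp: loop_system_def)
  have N: "0 < N" using a k_pos by simp
  obtain c where c: "0 < c" "\<And>j. c * (sum p L / lam ^ N) ^ j \<le>
    prob (\<Union>\<tau>\<in>{\<tau>. set \<tau> \<subseteq> L \<and> length \<tau> = Suc j}. cyl (concat \<tau> @ a))"
    by (rule prob_loop_cylinders_lower[OF sys]) blast
  let ?U = "\<lambda>j. \<Union>\<tau>\<in>{\<tau>. set \<tau> \<subseteq> L \<and> length \<tau> = Suc j}. cyl (concat \<tau> @ a)"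
  have "s ^ N \<le> sum p L / lam ^ N"
    using sum_p lam_pos by (simp add: r_def power_mult_distrib le_divide_eq)
  have U_sets: "?U j \<in> sets \<nu>" for j
    using finite_lists_length_eq[OF a(3), of "Suc j"] by auto
  have prefix: "cyl (concat \<tau> @ a) \<subseteq> cyl a" if "set \<tau> \<subseteq> L" for \<tau>
    using loop_concat_prefix[OF sys that] cylinder_append_subset append_take_drop_id by metis
  \<comment> \<open>Otherwise the union for \<open>j = 0\<close> would be empty, although its
    measure is at least \<open>c\<close>.\<close>
  have "cyl a \<noteq> {}"
  proof
    assume "cyl a = {}"
    then have "?U 0 = {}" using prefix by blast
    with c(2)[of 0] c(1) show False by simp
  qed
  then obtain \<delta> where \<delta>: "0 < \<delta>" "\<And>\<omega>. \<omega> \<in> cyl a \<Longrightarrow> \<delta> \<le> h \<omega>"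
    by (rule h_lower_bound[OF a(1)]) blast
  have "\<delta> * c / max 1 s ^ N * s ^ n \<le> measure \<mu> (E n)" for n
  proof -
    define j where "j = n div N"
    have jn: "j * N \<le> n" "n < Suc j * N"
      using div_mult_mod_eq[of n N] mod_less_divisor[OF N, of n] unfolding j_def mult_Suc by linarith+
    have "s ^ n \<le> max 1 s ^ N * s ^ (j * N)"
      using s N jn by (intro power_le_max_power_mult) (auto simp: j_def)
    then have "\<delta> * c / max 1 s ^ N * s ^ n \<le> \<delta> * c * s ^ (j * N)"
      using \<delta> c by (simp add: field_simps)
    also have "\<dots> \<le> \<delta> * c * (sum p L / lam ^ N) ^ j"
      using \<delta> c \<open>s ^ N \<le> sum p L / lam ^ N\<close> s
      by (intro mult_left_mono) (auto simp: power_mult mult.commute[of j] intro!: power_mono)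
    also have "\<dots> \<le> \<delta> * prob (?U j)" using c(2)[of j] \<delta> by simp
    also have "\<dots> \<le> measure \<mu> (E n)"
    proof (rule measure_mu_lower[OF E_sets U_sets _ \<delta>(1)])
      show "\<delta> \<le> h \<omega>" if "\<omega> \<in> ?U j" for \<omega> using that prefix \<delta>(2) by blast
      show "?U j \<subseteq> E n"
      proof (rule UN_least)
        fix \<tau> assume "\<tau> \<in> {\<tau>. set \<tau> \<subseteq> L \<and> length \<tau> = Suc j}"
        then have \<tau>: "set \<tau> \<subseteq> L" "length \<tau> = Suc j" by auto
        let ?w = "concat \<tau> @ a"
        \<comment> \<open>One letter comes from the strict inequality \<open>n < Suc j * N\<close>,
          the other from the closing block \<open>a\<close> of length at least one.\<close>
        have len: "n + 2 \<le> length ?w"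
          using length_loop_concat[OF sys \<tau>(1)] \<tau>(2) jn(2) a(1) k_pos by simp
        have "admissible (take (n + 2) ?w @ drop (n + 2) ?w)"
          unfolding append_take_drop_id by (rule admissible_loop_concat[OF sys \<tau>(1)])
        then have "admissible (take (n + 2) ?w)" by (simp only: successively_append_iff)
        with len have mem: "take (n + 2) ?w \<in> {w. length w = n + 2 \<and> admissible w}" by simp
        have "cyl ?w \<subseteq> cyl (take (n + 2) ?w)"
          using cylinder_append_subset[of X "take (n + 2) ?w" "drop (n + 2) ?w"]
          unfolding append_take_drop_id .
        also have "\<dots> \<subseteq> E n" unfolding Sigma_M_upto_eq by (rule UN_upper[OF mem])
        finally show "cyl ?w \<subseteq> E n" .
      qed
    qed
    finally show ?thesis .
  qed
  moreover have "0 < \<delta> * c / max 1 s ^ N" using \<delta> c by simp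
  ultimately show ?thesis by blast
qed

lemma mu_E_rate: "(\<lambda>n. 1 / real n * ln (measure \<mu> (E n))) \<longlonglongrightarrow> pressure Y \<phi> - pressure X \<phi>"
proof -
  have "(\<lambda>n. 1 / real n * ln (measure \<mu> (E n))) \<longlonglongrightarrow> ln (growth_rate / lam)"
    using growth_rate_pos by (intro growth_rate_tendsto mu_E_upper mu_E_lower) auto
  also have "ln (growth_rate / lam) = pressure Y \<phi> - pressure X \<phi>"
    using growth_rate_pos by (simp add: ln_div pressure_Y lam_eq)
  finally show ?thesis .
qed

end

theorem theorem3p7:
  fixes A M :: "'s::countable \<Rightarrow> 's \<Rightarrow> nat"
    and S\<^sub>0 :: "'s set"
    and \<theta> :: real
    and \<phi> :: "(nat \<Rightarrow> 's) \<Rightarrow> real"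
    and k :: nat
    and lam\<^sub>A :: real
    and h\<^sub>A :: "(nat \<Rightarrow> 's) \<Rightarrow> real"
    and \<nu>\<^sub>A :: "(nat \<Rightarrow> 's) measure"
  assumes "0 < \<theta>" and "\<theta> < 1"
    and "\<And>i j. A i j \<in> {0, 1}"
    and "S\<^sub>0 \<noteq> {}"
    and "\<And>i j. M i j \<in> {0, 1}"
    and "\<And>i j. M i j \<le> A i j"
    and "\<And>i j. i \<notin> S\<^sub>0 \<or> j \<notin> S\<^sub>0 \<Longrightarrow> M i j = 0"
    and "irreducible_matrix A"
    and "has_periodic_point (markov_shift S\<^sub>0 M)"
    and "k \<ge> 1"
    and "summable_potential (markov_shift UNIV A) \<phi>"
    and "lip_seminorm \<theta> (markov_shift UNIV A) (k + 1) \<phi> < \<infinity>"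
    and "ruelle_triplet \<theta> A \<phi> k lam\<^sub>A h\<^sub>A \<nu>\<^sub>A"
  shows "(\<lambda>n. 1 / real n *
            ln (measure (density \<nu>\<^sub>A (\<lambda>\<omega>. ennreal (h\<^sub>A \<omega>)))
                  (Sigma_M_upto (markov_shift UNIV A) M n)))
         \<longlonglongrightarrow> pressure (markov_shift S\<^sub>0 M) \<phi> - pressure (markov_shift UNIV A) \<phi>"
proof -
  have M: "A i j = 1 \<and> i \<in> S\<^sub>0 \<and> j \<in> S\<^sub>0" if "M i j = 1" for i j
    using that assms(3)[of i j] assms(6)[of i j] assms(7)[of i j] by auto
  interpret ruelle_potential A M S\<^sub>0 \<theta> \<phi> k lam\<^sub>A h\<^sub>A \<nu>\<^sub>A
    by unfold_locales (use assms M in blast)+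
  show ?thesis
    using mu_E_rate unfolding \<mu>_def X_def Y_def .
qed

end
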